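(* Let $f:\mathbb{R}^d\to\mathbb{R}$ be $\mu$-strongly convex and $L$-smooth and consider the noisy GMM iterations with Gaussian gradient noise, with the parameters $(\alpha,\beta,\gamma)=(\alpha_{\vartheta,\psi},\beta_{\vartheta,\psi},\gamma_{\vartheta,\psi})$, $(\vartheta,\psi)\in\mathcal{S}_0\cup\mathcal{S}_c$, described in the context. Write $\alpha,\beta,\gamma$ for these parameters. Let $$\mathtt{v}=\frac{2L^2}{\mu}\left(2(\beta-\gamma)^2+(1-\alpha L)^2(1+2\gamma+2\gamma^2)\right)+\frac{\vartheta}{2\alpha}\left(1-\sqrt{\vartheta\alpha\mu}\right),\qquad \theta_u^g=\frac{2\sqrt{\vartheta\mu}}{\alpha\left(8\mathtt{v}\sqrt\alpha+\sqrt{\vartheta\mu}\,(\vartheta+\alpha L)\right)}.$$ Then for $0<\theta<\theta_u^g$ and every $k\ge0$ the finite-horizon entropic risk $r_{k,\sigma^2}(\theta)$ is finite and $$r_{k,\sigma^2}(\theta)<\frac{\sigma^2d\,\alpha(\vartheta+\alpha L)}{(1-\bar\rho^2)\left(2-\theta\alpha(\vartheta+\alpha L)\right)}+\bar\rho^{2k}\,2\mathcal{V}_P(z_0),$$ where $\bar\rho^2<1$ is given by $$\bar\rho^2=\frac12\left(1-\sqrt{\vartheta\alpha\mu}+\frac{4\theta\alpha^2\mathtt{v}}{2-\theta\alpha(\vartheta+\alpha L)}\right)+\frac12\sqrt{\left(1-\sqrt{\vartheta\alpha\mu}+\frac{4\theta\alpha^2\mathtt{v}}{2-\theta\alpha(\vartheta+\alpha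 L)}\right)^2+\frac{16\theta\alpha^2\mathtt{v}}{2-\theta\alpha(\vartheta+\alpha L)}}.$$ Consequently, $$r_{\sigma^2}(\theta)\le\frac{\sigma^2d\,\alpha(\vartheta+\alpha L)}{(1-\bar\rho^2)\left(2-\theta\alpha(\vartheta+\alpha L)\right)}.$$
   Context: $0<\mu<L$, $\kappa=L/\mu$, $x_*$ is the unique minimizer of $f$. The noisy generalized momentum method (GMM) with parameters $(\alpha,\beta,\gamma)$ and deterministic initialization $x_0,x_{-1}\in\mathbb{R}^d$ is $$x_{k+1}=(1+\beta)x_k-\beta x_{k-1}-\alpha\left(\nabla f(y_k)+w_{k+1}\right),\qquad y_k=(1+\gamma)x_k-\gamma x_{k-1},\qquad k\ge0.$$ Noise assumption: for each $k$, $w_{k+1}\sim\mathcal{N}(0,\sigma^2I_d)$ for some $\sigma>0$, and $w_{k+1}$ is independent of the $\sigma$-algebra $\mathcal{F}_k$ generated by $x_0,\dots,x_k$. Put $z_k=[x_k^\top,x_{k-1}^\top]^\top$, $z_*=[x_*^\top,x_*^\top]^\top$. Parameter choice. Let $\mathcal{S}_0=\{(1,1)\}$, $\mathcal{S}_+=\{(\vartheta,\psi)\mid\psi>1,\ 1<\vartheta\le2-\frac1\psi\}$, $\mathcal{S}_-=\{(\vartheta,\psi)\mid0\le\psi<1,\ \max\{2-\frac1\psi,\frac1{1+\kappa(1-\psi)}\}\le\vartheta<1\}$ (for $\psi=0$ the maximum is read as $\frac1{1+\kappa}$), $$\mathcal{S}_1=\left\{(\vartheta,\psi)\;\middle|\;\psi\ne1,\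 \left[1-\sqrt{\tfrac{(1-\vartheta)\vartheta}{\kappa(1-\psi)}}\right]\left[1-\tfrac{(1-\vartheta)(\mu\psi^2-L(1-\psi)^2)}{L(1-\psi)\vartheta}\right]\le\left[1-\tfrac{(1-\vartheta)\psi}{\kappa(1-\psi)}\right]^2\right\},$$ $\mathcal{S}_c=(\mathcal{S}_-\cup\mathcal{S}_+)\cap\mathcal{S}_1$. For $(\vartheta,\psi)\in\mathcal{S}_0\cup\mathcal{S}_c$: $\alpha_{\vartheta,\psi}=\frac{1-\vartheta}{L(1-\psi)}$ if $(\vartheta,\psi)\in\mathcal{S}_c$, $\alpha_{\vartheta,\psi}$ is any number in $(0,\frac1L]$ if $(\vartheta,\psi)\in\mathcal{S}_0$; $\beta_{\vartheta,\psi}=\frac{1-\sqrt{\vartheta\alpha_{\vartheta,\psi}\mu}}{1-\alpha_{\vartheta,\psi}\psi\mu}\left[1-\sqrt{\frac{\alpha_{\vartheta,\psi}\mu}{\vartheta}}\right]$; $\gamma_{\vartheta,\psi}=\psi\beta_{\vartheta,\psi}$. Lyapunov function: $\mathcal{V}_P(z_k)=(z_k-z_* )^\top P(z_k-z_* )+f(x_k)-f(x_* )$ with $P=(\tilde p\tilde p^\top)\otimes I_d$, $\tilde p=\left[\sqrt{\frac{\vartheta}{2\alpha_{\vartheta,\psi}}},\ -\sqrt{\frac{\vartheta}{2\alpha_{\vartheta,\psi}}}+\sqrt{\frac\mu2}\right]^\top$. Entropic risks ($\theta>0$): $r_{k,\sigma^2}(\theta)=\frac{2\sigma^2}{\theta}\log\mathbb{E}\left[e^{\frac{\theta}{2\sigma^2}(f(x_k)-f(x_*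 ))}\right]$ and $r_{\sigma^2}(\theta)=\limsup_{k\to\infty}r_{k,\sigma^2}(\theta)$. *)

theory Defs
  imports "HOL-Probability.Probability"
begin

section \<open>Smooth strongly convex functions\<close>

definition grad :: "('a::real_inner \<Rightarrow> real) \<Rightarrow> 'a \<Rightarrow> 'a" where
  "grad f x = (THE D. GDERIV f x :> D)"

definition L_smooth :: "real \<Rightarrow> ('a::real_inner \<Rightarrow> real) \<Rightarrow> bool" where
  "L_smooth L f \<longleftrightarrow> (\<forall>x. f differentiable (at x)) \<and> L-lipschitz_on UNIV (grad f)"

definition strongly_convex :: "real \<Rightarrow> ('a::real_inner \<Rightarrow> real) \<Rightarrow> bool" where
  "strongly_convex \<mu> f \<longleftrightarrow> convex_on UNIV (\<lambda>x. f x - \<mu> / 2 * (norm x)\<^sup>2)"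

section \<open>The iteration and its noise\<close>

text \<open>The pair at index \<open>k\<close> is \<open>(x\<^sub>k, x\<^bsub>k-1\<^esub>)\<close>, which avoids the index \<open>-1\<close>.
  The noise entering \<open>x\<^bsub>k+1\<^esub>\<close> is \<open>w (Suc k)\<close>; the value \<open>w 0\<close> is never used.\<close>

primrec gmm_pair :: "('a::real_inner \<Rightarrow> real) \<Rightarrow> real \<Rightarrow> real \<Rightarrow> real \<Rightarrow> 'a \<Rightarrow> 'a \<Rightarrow>
    (nat \<Rightarrow> 'a) \<Rightarrow> nat \<Rightarrow> 'a \<times> 'a" where
  "gmm_pair f \<alpha> \<beta> \<gamma> x0 xm1 w 0 = (x0, xm1)"
| "gmm_pair f \<alpha> \<beta> \<gamma> x0 xm1 w (Suc k) =
    (let (x, x') = gmm_pair f \<alpha> \<beta> \<gamma> x0 xm1 w k;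
         y = (1 + \<gamma>) *\<^sub>R x - \<gamma> *\<^sub>R x'
     in ((1 + \<beta>) *\<^sub>R x - \<beta> *\<^sub>R x' - \<alpha> *\<^sub>R (grad f y + w (Suc k)), x))"

definition gmm :: "('a::real_inner \<Rightarrow> real) \<Rightarrow> real \<Rightarrow> real \<Rightarrow> real \<Rightarrow> 'a \<Rightarrow> 'a \<Rightarrow>
    (nat \<Rightarrow> 'w \<Rightarrow> 'a) \<Rightarrow> nat \<Rightarrow> 'w \<Rightarrow> 'a" where
  "gmm f \<alpha> \<beta> \<gamma> x0 xm1 w k \<omega> = fst (gmm_pair f \<alpha> \<beta> \<gamma> x0 xm1 (\<lambda>j. w j \<omega>) k)"

text \<open>The density of the centred normal law with covariance \<open>\<sigma>\<^sup>2 I\<close>.\<close>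

definition gaussian_density :: "real \<Rightarrow> real ^ 'n \<Rightarrow> real" where
  "gaussian_density \<sigma> v =
    (1 / sqrt (2 * pi * \<sigma>\<^sup>2)) ^ CARD('n) * exp (- (norm v)\<^sup>2 / (2 * \<sigma>\<^sup>2))"

definition generated_upto :: "'w measure \<Rightarrow> (nat \<Rightarrow> 'w \<Rightarrow> 'a::topological_space) \<Rightarrow> nat \<Rightarrow> 'w set set"
  where
  "generated_upto M x k =
    sigma_sets (space M) (\<Union>i\<in>{..k}. {x i -` A \<inter> space M | A. A \<in> sets borel})"

definition gaussian_gradient_noise ::
    "'w measure \<Rightarrow> real \<Rightarrow> (nat \<Rightarrow> 'w \<Rightarrow> real ^ 'n) \<Rightarrow> (nat \<Rightarrow> 'w \<Rightarrow> real ^ 'n) \<Rightarrow> bool" where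
  "gaussian_gradient_noise M \<sigma> w x \<longleftrightarrow>
    (\<forall>k. distributed M lborel (w (Suc k)) (\<lambda>v. ennreal (gaussian_density \<sigma> v)) \<and>
         prob_space.indep_set M
           {w (Suc k) -` A \<inter> space M | A. A \<in> sets borel}
           (generated_upto M x k))"

section \<open>Parameters\<close>

definition S_zero :: "(real \<times> real) set" where
  "S_zero = {(1, 1)}"

definition S_plus :: "(real \<times> real) set" where
  "S_plus = {(vt, \<psi>). \<psi> > 1 \<and> 1 < vt \<and> vt \<le> 2 - 1 / \<psi>}"

text \<open>At \<open>\<psi> = 0\<close> the term \<open>2 - 1 / \<psi>\<close> means \<open>-\<infinity>\<close>, whereas division by zero
  would make it \<open>2\<close>; hence the case distinction.\<close>

definition S_minus :: "real \<Rightarrow> (real \<times> real) set" where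
  "S_minus \<kappa> = {(vt, \<psi>). 0 \<le> \<psi> \<and> \<psi> < 1 \<and>
     (if \<psi> = 0 then 1 / (1 + \<kappa>) else max (2 - 1 / \<psi>) (1 / (1 + \<kappa> * (1 - \<psi>)))) \<le> vt \<and> vt < 1}"

text \<open>The radicand below is nonnegative on \<open>S_minus\<close> and \<open>S_plus\<close>, with which \<open>S_one\<close> is
  intersected.\<close>

definition S_one :: "real \<Rightarrow> real \<Rightarrow> (real \<times> real) set" where
  "S_one \<mu> L = {(vt, \<psi>). \<psi> \<noteq> 1 \<and>
     (1 - sqrt ((1 - vt) * vt / ((L / \<mu>) * (1 - \<psi>)))) *
     (1 - (1 - vt) * (\<mu> * \<psi>\<^sup>2 - L * (1 - \<psi>)\<^sup>2) / (L * (1 - \<psi>) * vt))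
     \<le> (1 - (1 - vt) * \<psi> / ((L / \<mu>) * (1 - \<psi>)))\<^sup>2}"

definition S_c :: "real \<Rightarrow> real \<Rightarrow> (real \<times> real) set" where
  "S_c \<mu> L = (S_minus (L / \<mu>) \<union> S_plus) \<inter> S_one \<mu> L"

definition gmm_stepsize :: "real \<Rightarrow> real \<Rightarrow> real \<Rightarrow> real \<Rightarrow> real \<Rightarrow> bool" where
  "gmm_stepsize \<mu> L vt \<psi> \<alpha> \<longleftrightarrow>
     ((vt, \<psi>) \<in> S_c \<mu> L \<longrightarrow> \<alpha> = (1 - vt) / (L * (1 - \<psi>))) \<and>
     ((vt, \<psi>) \<in> S_zero \<longrightarrow> 0 < \<alpha> \<and> \<alpha> \<le> 1 / L)"

definition gmm_beta :: "real \<Rightarrow> real \<Rightarrow> real \<Rightarrow> real \<Rightarrow> real" where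
  "gmm_beta \<mu> vt \<psi> \<alpha> =
     (1 - sqrt (vt * \<alpha> * \<mu>)) / (1 - \<alpha> * \<psi> * \<mu>) * (1 - sqrt (\<alpha> * \<mu> / vt))"

section \<open>The Lyapunov function\<close>

definition outer :: "real ^ 'n \<Rightarrow> real ^ 'm \<Rightarrow> real ^ 'm ^ 'n" where
  "outer u v = (\<chi> i j. u $ i * v $ j)"

definition kronecker :: "real ^ 'b ^ 'a \<Rightarrow> real ^ 'd ^ 'c \<Rightarrow> real ^ ('b \<times> 'd) ^ ('a \<times> 'c)" where
  "kronecker A B = (\<chi> i j. A $ fst i $ fst j * B $ snd i $ snd j)"

text \<open>Vectors with \<open>2d\<close> entries are indexed by a block number and a position in the block.\<close>

definition stack :: "real ^ 'n \<Rightarrow> real ^ 'n \<Rightarrow> real ^ (2 \<times> 'n)" where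
  "stack x y = (\<chi> i. (if fst i = 1 then x else y) $ snd i)"

definition lyap_p :: "real \<Rightarrow> real \<Rightarrow> real \<Rightarrow> real ^ 2" where
  "lyap_p \<mu> vt \<alpha> = vector [sqrt (vt / (2 * \<alpha>)), - sqrt (vt / (2 * \<alpha>)) + sqrt (\<mu> / 2)]"

definition lyap_P :: "real \<Rightarrow> real \<Rightarrow> real \<Rightarrow> real ^ (2 \<times> 'n::finite) ^ (2 \<times> 'n)" where
  "lyap_P \<mu> vt \<alpha> = kronecker (outer (lyap_p \<mu> vt \<alpha>) (lyap_p \<mu> vt \<alpha>)) (mat 1)"

definition lyap :: "(real ^ 'n \<Rightarrow> real) \<Rightarrow> real ^ 'n \<Rightarrow> real ^ (2 \<times> 'n) ^ (2 \<times> 'n) \<Rightarrow>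
    real ^ 'n \<Rightarrow> real ^ 'n \<Rightarrow> real" where
  "lyap f xs P x x' =
     (stack x x' - stack xs xs) \<bullet> (P *v (stack x x' - stack xs xs)) + f x - f xs"

section \<open>Entropic risk\<close>

text \<open>An extended real, equal to \<open>\<infinity>\<close> when the exponential moment is infinite.\<close>

definition entropic_risk :: "'w measure \<Rightarrow> real \<Rightarrow> real \<Rightarrow> ('w \<Rightarrow> real) \<Rightarrow> ereal" where
  "entropic_risk M \<sigma> \<theta> X =
    (let E = (\<integral>\<^sup>+ \<omega>. ennreal (exp (\<theta> / (2 * \<sigma>\<^sup>2) * X \<omega>)) \<partial>M)
     in if E = \<infinity> then \<infinity> else ereal (2 * \<sigma>\<^sup>2 / \<theta> * ln (enn2real E)))"

section \<open>The constants of the risk bound\<close>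

definition v_const :: "real \<Rightarrow> real \<Rightarrow> real \<Rightarrow> real \<Rightarrow> real \<Rightarrow> real \<Rightarrow> real" where
  "v_const \<mu> L vt \<alpha> \<beta> \<gamma> =
     2 * L\<^sup>2 / \<mu> * (2 * (\<beta> - \<gamma>)\<^sup>2 + (1 - \<alpha> * L)\<^sup>2 * (1 + 2 * \<gamma> + 2 * \<gamma>\<^sup>2))
     + vt / (2 * \<alpha>) * (1 - sqrt (vt * \<alpha> * \<mu>))"

definition theta_max :: "real \<Rightarrow> real \<Rightarrow> real \<Rightarrow> real \<Rightarrow> real \<Rightarrow> real" where
  "theta_max \<mu> L vt \<alpha> v =
     2 * sqrt (vt * \<mu>) / (\<alpha> * (8 * v * sqrt \<alpha> + sqrt (vt * \<mu>) * (vt + \<alpha> * L)))"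

definition rho_bar_sq :: "real \<Rightarrow> real \<Rightarrow> real \<Rightarrow> real \<Rightarrow> real \<Rightarrow> real \<Rightarrow> real" where
  "rho_bar_sq \<mu> L vt \<alpha> v \<theta> =
    (let D = 2 - \<theta> * \<alpha> * (vt + \<alpha> * L);
         a = 1 - sqrt (vt * \<alpha> * \<mu>) + 4 * \<theta> * \<alpha>\<^sup>2 * v / D
     in 1 / 2 * a + 1 / 2 * sqrt (a\<^sup>2 + 16 * \<theta> * \<alpha>\<^sup>2 * v / D))"

end

theory Submission
  imports Defs
begin

text \<open>The Lyapunov function is an energy \<open>V\<close> that dominates the gap \<open>f x - f xs\<close>, and a noiseless step
  of the method multiplies it by at most \<open>1 - r\<close>, where \<open>r = sqrt (\<vartheta> \<alpha> \<mu>)\<close> (\<open>energy_step_le\<close>). The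
  noise changes \<open>V\<close> by a linear term and by at most \<open>\<alpha>/2 (\<vartheta> + \<alpha> L) |w|\<^sup>2\<close>. The exponential
  moment of this bound is a Gaussian integral in closed form. The squared norm of the linear coefficient is
  at most \<open>2 \<alpha> (\<vartheta> + \<alpha> L)\<close> times the energy of the noiseless successor
  (\<open>norm_noise_direction_le\<close>). With \<open>\<tau> = \<theta> / (2 \<sigma>\<^sup>2)\<close> and \<open>D = 2 - \<theta> \<alpha> (\<vartheta> + \<alpha> L)\<close> this gives, conditionally
  on the past, that the expectation of \<open>exp (\<tau> V)\<close> after one step is at most \<open>exp (\<tau> (b + \<rho> V))\<close>,
  where \<open>\<rho> = 2 (1 - r) / D\<close> and \<open>b = \<sigma>\<^sup>2 d \<alpha> (\<vartheta> + \<alpha> L) / D\<close>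
  (\<open>expected_exp_energy_step_le\<close>).

  As \<open>\<rho> < 1\<close>, convexity of the exponential turns this into a recursion \<open>R' = b + \<rho> R\<close> for numbers
  \<open>R\<close> such that the exponential moment of \<open>V\<close> is at most \<open>exp (\<tau> R)\<close>
  (\<open>exp_moment_energy_le\<close>). The entropic risk of the gap is at most \<open>R\<close>, and \<open>R\<close> tends to
  \<open>b / (1 - \<rho>)\<close> geometrically.

  The recursion involves one energy only, and its rate \<open>\<rho>\<close> is at most the rate \<open>rho_bar_sq\<close> of the
  theorem, which is the dominant root of a recursion of order two (\<open>risk_parameter_rate\<close>). The
  comparison of the two rates rests on \<open>\<alpha> L \<le> 3 \<vartheta>\<close>. On \<open>S_minus\<close> this estimate is a consequence
  of the inequality that defines \<open>S_one\<close> (\<open>S_one_violated_beyond_ratio\<close>).\<close>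

section \<open>Gradient inequalities\<close>

text \<open>The definite description in \<open>grad\<close> denotes something because, in finite dimension, the
  derivative is the inner product with the vector of its values on a basis.\<close>

lemma GDERIV_grad:
  fixes f :: "'a::euclidean_space \<Rightarrow> real"
  assumes "f differentiable (at x)"
  shows "GDERIV f x :> grad f x"
proof -
  obtain f' where f': "(f has_derivative f') (at x)"
    using assms by (auto simp: differentiable_def)
  interpret linear f' by (rule has_derivative_linear[OF f'])
  define D where "D = (\<Sum>b\<in>Basis. f' b *\<^sub>R b)"
  have "f' h = h \<bullet> D" for h
  proof -
    have "f' h = f' (\<Sum>b\<in>Basis. (h \<bullet> b) *\<^sub>R b)"
      by (simp add: euclidean_representation)
    also have "\<dots> = h \<bullet> D"
      by (simp add: sum scaleR D_def inner_sum_right mult.commute)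
    finally show ?thesis .
  qed
  then have "f' = (\<lambda>h. h \<bullet> D)" by auto
  then have D: "GDERIV f x :> D"
    using f' by (simp add: gderiv_def)
  have "D' = D" if "GDERIV f x :> D'" for D'
  proof -
    have "(\<lambda>h. h \<bullet> D') = (\<lambda>h. h \<bullet> D)"
      using D that unfolding gderiv_def by (rule has_derivative_unique[rotated])
    then have "(D' - D) \<bullet> D' = (D' - D) \<bullet> D" by metis
    then have "(D' - D) \<bullet> (D' - D) = 0" by (simp add: inner_diff_right)
    then show ?thesis by simp
  qed
  with D show ?thesis
    unfolding grad_def by (rule theI2) 
qed

lemma has_real_derivative_along_line:
  fixes f :: "'a::euclidean_space \<Rightarrow> real"
  assumes "L_smooth L f"
  shows "((\<lambda>s. f (x + s *\<^sub>R h)) has_real_derivative grad f (x + s *\<^sub>R h) \<bullet> h) (at s within A)"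
proof -
  have "(f has_derivative (\<lambda>v. v \<bullet> grad f (x + s *\<^sub>R h))) (at (x + s *\<^sub>R h))"
    using GDERIV_grad[of f "x + s *\<^sub>R h"] assms by (simp add: L_smooth_def gderiv_def)
  moreover have "((\<lambda>s. x + s *\<^sub>R h) has_derivative (\<lambda>u. u *\<^sub>R h)) (at s within A)"
    by (auto intro!: derivative_eq_intros)
  ultimately have "((\<lambda>s. f (x + s *\<^sub>R h)) has_derivative
      (\<lambda>u. (u *\<^sub>R h) \<bullet> grad f (x + s *\<^sub>R h))) (at s within A)"
    by (rule has_derivative_compose[rotated])
  then show ?thesis
    by (simp add: has_field_derivative_def inner_commute mult.commute[of _ "_ \<bullet> _"] cong: if_cong)
qed

text \<open>The difference of the two sides at \<open>x + s h\<close> has nonpositive derivative in \<open>s\<close>, by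
  Cauchy--Schwarz and the Lipschitz bound on the gradient.\<close>

lemma L_smooth_upper_bound:
  fixes f :: "'a::euclidean_space \<Rightarrow> real"
  assumes f: "L_smooth L f"
  shows "f (x + h) \<le> f x + grad f x \<bullet> h + L / 2 * (norm h)\<^sup>2"
proof -
  define \<phi> where "\<phi> s = f (x + s *\<^sub>R h) - s * (grad f x \<bullet> h) - L / 2 * s\<^sup>2 * (norm h)\<^sup>2" for s
  have "\<phi> 1 \<le> \<phi> 0"
  proof (rule DERIV_nonpos_imp_nonincreasing[where f = \<phi> and a = 0 and b = 1])
    fix s :: real assume s: "0 \<le> s" "s \<le> 1"
    define m where "m = grad f (x + s *\<^sub>R h) \<bullet> h - grad f x \<bullet> h - L * s * (norm h)\<^sup>2"
    have "(\<phi> has_real_derivative m) (at s)"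
      unfolding \<phi>_def m_def
      by (auto intro!: derivative_eq_intros has_real_derivative_along_line[OF f])
    moreover have "m \<le> 0"
    proof -
      have "(grad f (x + s *\<^sub>R h) - grad f x) \<bullet> h \<le> norm (grad f (x + s *\<^sub>R h) - grad f x) * norm h"
        by (rule norm_cauchy_schwarz)
      also have "norm (grad f (x + s *\<^sub>R h) - grad f x) \<le> L * (s * norm h)"
        using lipschitz_onD[of L UNIV "grad f" "x + s *\<^sub>R h" x] f s
        by (simp add: L_smooth_def dist_norm)
      finally show ?thesis
        by (simp add: m_def inner_diff_left power2_eq_square mult_right_mono mult.assoc)
    qed
    ultimately show "\<exists>m. (\<phi> has_real_derivative m) (at s) \<and> m \<le> 0" by blast
  qed simp
  then show ?thesis by (simp add: \<phi>_def)
qed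

text \<open>The tangent inequality for the convex function \<open>f - \<mu>/2 |.|\<^sup>2\<close> restricted to a line.\<close>

lemma strongly_convex_lower_bound:
  fixes f :: "'a::euclidean_space \<Rightarrow> real"
  assumes f: "L_smooth L f" and sc: "strongly_convex \<mu> f"
  shows "f x + grad f x \<bullet> h + \<mu> / 2 * (norm h)\<^sup>2 \<le> f (x + h)"
proof -
  define g where "g s = f (x + s *\<^sub>R h) - \<mu> / 2 * (norm (x + s *\<^sub>R h))\<^sup>2" for s
  have "convex_on UNIV g"
  proof (rule convex_onI)
    fix t a b :: real assume t: "0 < t" "t < 1"
    have eq: "x + ((1 - t) *\<^sub>R a + t *\<^sub>R b) *\<^sub>R h
        = (1 - t) *\<^sub>R (x + a *\<^sub>R h) + t *\<^sub>R (x + b *\<^sub>R h)"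
      by (simp add: algebra_simps)
    show "g ((1 - t) *\<^sub>R a + t *\<^sub>R b) \<le> (1 - t) * g a + t * g b"
      unfolding g_def eq using t sc unfolding strongly_convex_def
      by (intro convex_onD) auto
  qed simp
  moreover have "(g has_real_derivative grad f x \<bullet> h - \<mu> * (x \<bullet> h)) (at 0)"
    unfolding g_def power2_norm_eq_inner
    using has_real_derivative_along_line[OF f, of x h 0 UNIV]
    by (auto intro!: derivative_eq_intros simp: inner_commute algebra_simps)
  ultimately have "g 1 - g 0 \<ge> (grad f x \<bullet> h - \<mu> * (x \<bullet> h)) * (1 - 0)"
    by (intro convex_on_imp_above_tangent) auto
  then show ?thesis
    by (simp add: g_def power2_norm_eq_inner inner_add_left inner_add_right inner_commute
        algebra_simps)
qed

text \<open>A gradient step of length \<open>1/L\<close> lowers \<open>f\<close> by at least \<open>|grad f x|\<^sup>2/(2L)\<close>, and it cannot get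
  below the minimum.\<close>

lemma norm_grad_le_gap:
  fixes f :: "'a::euclidean_space \<Rightarrow> real"
  assumes f: "L_smooth L f" and L: "0 < L" and min: "\<And>z. f xs \<le> f z"
  shows "(norm (grad f x))\<^sup>2 \<le> 2 * L * (f x - f xs)"
proof -
  have "f xs \<le> f (x + (- 1 / L) *\<^sub>R grad f x)" by (rule min)
  also have "\<dots> \<le> f x + grad f x \<bullet> ((- 1 / L) *\<^sub>R grad f x)
      + L / 2 * (norm ((- 1 / L) *\<^sub>R grad f x))\<^sup>2"
    by (rule L_smooth_upper_bound[OF f])
  also have "\<dots> = f x - (norm (grad f x))\<^sup>2 / (2 * L)"
    using L by (simp add: power_mult_distrib power2_norm_eq_inner[symmetric] field_simps power2_eq_square)
  finally show ?thesis using L by (simp add: field_simps)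
qed

section \<open>Gaussian exponential moments\<close>

text \<open>Completing the square turns the integrand into a multiple of the normal density with mean
  \<open>\<sigma>\<^sup>2 a / q\<close> and variance \<open>\<sigma>\<^sup>2 / q\<close>, where \<open>q = 1 - 2 b \<sigma>\<^sup>2\<close>.\<close>

lemma nn_integral_normal_exp_quadratic:
  fixes a b \<sigma> :: real
  assumes \<sigma>: "0 < \<sigma>" and b: "2 * b * \<sigma>\<^sup>2 < 1"
  shows "(\<integral>\<^sup>+ x. ennreal (1 / sqrt (2 * pi * \<sigma>\<^sup>2) * exp (- x\<^sup>2 / (2 * \<sigma>\<^sup>2)) * exp (a * x + b * x\<^sup>2)) \<partial>lborel)
    = ennreal (1 / sqrt (1 - 2 * b * \<sigma>\<^sup>2) * exp (\<sigma>\<^sup>2 * a\<^sup>2 / (2 * (1 - 2 * b * \<sigma>\<^sup>2))))"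
proof -
  define q where "q = 1 - 2 * b * \<sigma>\<^sup>2"
  define s where "s = \<sigma> / sqrt q"
  define m where "m = \<sigma>\<^sup>2 * a / q"
  define C where "C = 1 / sqrt q * exp (\<sigma>\<^sup>2 * a\<^sup>2 / (2 * q))"
  have C: "0 \<le> C" unfolding C_def using b by (simp add: q_def)
  have q: "0 < q" using b by (simp add: q_def)
  have s: "0 < s" "s\<^sup>2 = \<sigma>\<^sup>2 / q" using q \<sigma> by (simp_all add: s_def power_divide)
  have eq: "1 / sqrt (2 * pi * \<sigma>\<^sup>2) * exp (- x\<^sup>2 / (2 * \<sigma>\<^sup>2)) * exp (a * x + b * x\<^sup>2)
      = C * normal_density m s x" for x
  proof -
    have bq: "b = (1 - q) / (2 * \<sigma>\<^sup>2)" using \<sigma> by (simp add: q_def)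
    have "- x\<^sup>2 / (2 * \<sigma>\<^sup>2) + (a * x + b * x\<^sup>2) = \<sigma>\<^sup>2 * a\<^sup>2 / (2 * q) + (- (x - m)\<^sup>2 / (2 * s\<^sup>2))"
      unfolding s m_def bq using \<sigma> q by (simp add: field_simps power2_eq_square)
    then have "exp (- x\<^sup>2 / (2 * \<sigma>\<^sup>2)) * exp (a * x + b * x\<^sup>2)
        = exp (\<sigma>\<^sup>2 * a\<^sup>2 / (2 * q)) * exp (- (x - m)\<^sup>2 / (2 * s\<^sup>2))"
      by (simp only: exp_add[symmetric])
    moreover have "sqrt (2 * pi * s\<^sup>2) = sqrt (2 * pi * \<sigma>\<^sup>2) / sqrt q"
      by (simp add: s(2) real_sqrt_divide)
    ultimately show ?thesis
      using q by (simp add: C_def normal_density_def mult.assoc)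
  qed
  have "(\<integral>\<^sup>+ x. ennreal (C * normal_density m s x) \<partial>lborel) = ennreal C * (\<integral>\<^sup>+ x. ennreal (normal_density m s x) \<partial>lborel)"
    using C by (subst nn_integral_cmult[symmetric]) (auto simp: ennreal_mult)
  also have "(\<integral>\<^sup>+ x. ennreal (normal_density m s x) \<partial>lborel) = 1"
    using prob_space.emeasure_space_1[OF prob_space_normal_density[OF s(1), of m]]
    by (simp add: emeasure_density)
  finally show ?thesis unfolding eq by (simp add: C_def q_def)
qed

text \<open>The integrand is a product over the coordinates, so this is a power of the scalar integral.\<close>

lemma nn_integral_gaussian_exp_quadratic:
  fixes a :: "real ^ 'n" and b \<sigma> :: real
  assumes \<sigma>: "0 < \<sigma>" and b: "2 * b * \<sigma>\<^sup>2 < 1"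
  shows "(\<integral>\<^sup>+ w. ennreal (gaussian_density \<sigma> w) * ennreal (exp (a \<bullet> w + b * (norm w)\<^sup>2)) \<partial>lborel)
    = ennreal ((1 / sqrt (1 - 2 * b * \<sigma>\<^sup>2)) ^ CARD('n)
        * exp (\<sigma>\<^sup>2 * (norm a)\<^sup>2 / (2 * (1 - 2 * b * \<sigma>\<^sup>2))))"
proof -
  define \<phi> where "\<phi> i x = 1 / sqrt (2 * pi * \<sigma>\<^sup>2) * exp (- x\<^sup>2 / (2 * \<sigma>\<^sup>2)) * exp (a \<bullet> i * x + b * x\<^sup>2)"
    for i :: "real ^ 'n" and x
  have nrm: "(norm w)\<^sup>2 = (\<Sum>i\<in>Basis. (w \<bullet> i)\<^sup>2)" for w :: "real ^ 'n"
    unfolding power2_norm_eq_inner by (subst euclidean_inner) (simp add: power2_eq_square)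
  have pr: "gaussian_density \<sigma> w * exp (a \<bullet> w + b * (norm w)\<^sup>2) = (\<Prod>i\<in>Basis. \<phi> i (w \<bullet> i))" for w
  proof -
    have "exp (- (norm w)\<^sup>2 / (2 * \<sigma>\<^sup>2)) = (\<Prod>i\<in>Basis. exp (- (w \<bullet> i)\<^sup>2 / (2 * \<sigma>\<^sup>2)))"
      unfolding nrm by (subst exp_sum[symmetric]) (simp_all add: sum_divide_distrib sum_negf)
    moreover have "exp (a \<bullet> w + b * (norm w)\<^sup>2) = (\<Prod>i\<in>Basis. exp (a \<bullet> i * (w \<bullet> i) + b * (w \<bullet> i)\<^sup>2))"
      unfolding nrm
      by (subst exp_sum[symmetric]) (simp_all add: sum.distrib sum_distrib_left euclidean_inner[of a w])
    ultimately show ?thesis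
      unfolding gaussian_density_def \<phi>_def prod.distrib by simp
  qed
  have \<phi>0: "0 \<le> \<phi> i x" for i x by (simp add: \<phi>_def)
  have "(\<integral>\<^sup>+ w. ennreal (gaussian_density \<sigma> w) * ennreal (exp (a \<bullet> w + b * (norm w)\<^sup>2)) \<partial>lborel)
      = (\<integral>\<^sup>+ w. (\<Prod>i\<in>Basis. ennreal (\<phi> i (w \<bullet> i))) \<partial>lborel)"
    by (simp add: ennreal_mult''[symmetric] pr prod_ennreal \<phi>0)
  also have "\<dots> = (\<Prod>i\<in>Basis. \<integral>\<^sup>+ x. ennreal (\<phi> i x) \<partial>lborel)"
    by (rule nn_integral_lborel_prod) (simp_all add: \<phi>_def)
  also have "\<dots> = (\<Prod>i\<in>(Basis :: (real ^ 'n) set).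
      ennreal (1 / sqrt (1 - 2 * b * \<sigma>\<^sup>2) * exp (\<sigma>\<^sup>2 * (a \<bullet> i)\<^sup>2 / (2 * (1 - 2 * b * \<sigma>\<^sup>2)))))"
    unfolding \<phi>_def by (simp only: nn_integral_normal_exp_quadratic[OF \<sigma> b])
  also have "\<dots> = ennreal (\<Prod>i\<in>(Basis :: (real ^ 'n) set).
      1 / sqrt (1 - 2 * b * \<sigma>\<^sup>2) * exp (\<sigma>\<^sup>2 * (a \<bullet> i)\<^sup>2 / (2 * (1 - 2 * b * \<sigma>\<^sup>2))))"
    using b by (intro prod_ennreal) auto
  also have "(\<Prod>i\<in>(Basis :: (real ^ 'n) set).
      1 / sqrt (1 - 2 * b * \<sigma>\<^sup>2) * exp (\<sigma>\<^sup>2 * (a \<bullet> i)\<^sup>2 / (2 * (1 - 2 * b * \<sigma>\<^sup>2))))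
    = (1 / sqrt (1 - 2 * b * \<sigma>\<^sup>2)) ^ CARD('n) * exp (\<sigma>\<^sup>2 * (norm a)\<^sup>2 / (2 * (1 - 2 * b * \<sigma>\<^sup>2)))"
    unfolding nrm prod.distrib
    by (simp add: exp_sum[symmetric] sum_divide_distrib sum_distrib_left)
  finally show ?thesis .
qed

section \<open>One step of a tuned method\<close>

text \<open>The locale records what the analysis of one step needs from the parameters; \<open>t\<close> is \<open>\<vartheta>\<close> and
  \<open>s = sqrt (\<alpha> \<mu> / \<vartheta>)\<close>, so that \<open>t s = sqrt (\<vartheta> \<alpha> \<mu>)\<close>. The last conditions act on the coefficients
  of the quadratic form in the proof of \<open>energy_step_le\<close> below: \<open>momentum\<close> and \<open>stepsize\<close> make two
  mixed coefficients vanish, \<open>stepsize_le\<close> and \<open>momentum_le\<close> make two diagonal ones nonpositive.\<close>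

locale tuned_gmm =
  fixes f :: "real ^ 'd \<Rightarrow> real" and xs :: "real ^ 'd"
    and \<mu> L \<alpha> \<beta> \<gamma> \<psi> t s :: real
  assumes smooth: "L_smooth L f" and strongly_convex: "strongly_convex \<mu> f"
    and minimizer: "\<And>z. f xs \<le> f z"
    and L_pos: "0 < L" and \<alpha>_pos: "0 < \<alpha>" and t_pos: "0 < t" and s_pos: "0 < s"
    and \<alpha>_\<mu>: "\<alpha> * \<mu> = t * s\<^sup>2" and ts_less_1: "t * s < 1"
    and momentum: "\<beta> * (1 - \<alpha> * \<psi> * \<mu>) = (1 - t * s) * (1 - s)"
    and extrapolation: "\<gamma> = \<psi> * \<beta>"
    and stepsize: "\<alpha> * L * (1 - \<psi>) = 1 - t"
    and stepsize_le: "t + \<alpha> * L \<le> 2"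
    and momentum_le: "\<beta>\<^sup>2 * (t + \<alpha> * L * (1 - \<psi>)\<^sup>2 - \<alpha> * \<mu> * \<psi>\<^sup>2) \<le> t * ((1 - t * s) * (1 - s)\<^sup>2)"
begin

definition step :: "real ^ 'd \<Rightarrow> real ^ 'd \<Rightarrow> real ^ 'd" where
  "step x x' = (1 + \<beta>) *\<^sub>R x - \<beta> *\<^sub>R x' - \<alpha> *\<^sub>R grad f ((1 + \<gamma>) *\<^sub>R x - \<gamma> *\<^sub>R x')"

text \<open>This is the Lyapunov function with its Kronecker product multiplied out; see \<open>lyap_P_eq\<close>.\<close>

definition energy :: "real ^ 'd \<Rightarrow> real ^ 'd \<Rightarrow> real" where
  "energy x x' = t / (2 * \<alpha>) * (norm ((x - x') + s *\<^sub>R (x' - xs)))\<^sup>2 + (f x - f xs)"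

text \<open>The coefficient of the noise, up to sign, in the first-order expansion of the energy
  around the noiseless successor \<open>x1\<close> of \<open>x\<close>.\<close>

definition noise_direction :: "real ^ 'd \<Rightarrow> real ^ 'd \<Rightarrow> real ^ 'd" where
  "noise_direction x1 x = \<alpha> *\<^sub>R grad f x1 + t *\<^sub>R ((x1 - x) + s *\<^sub>R (x - xs))"

lemma gap_le_energy: "f x - f xs \<le> energy x x'"
  using t_pos \<alpha>_pos by (simp add: energy_def)

lemma energy_nonneg: "0 \<le> energy x x'"
  using gap_le_energy[of x x'] minimizer[of x] by linarith

text \<open>Write \<open>e = x - xs\<close>, \<open>d = x - x'\<close> and \<open>G\<close> for the gradient at the extrapolated point \<open>y\<close>. One
  descent inequality (from \<open>y\<close> to the new point) and two strong convexity inequalities (from \<open>y\<close> to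
  \<open>x\<close> with weight \<open>1 - t s\<close>, and to \<open>xs\<close> with weight \<open>t s\<close>) eliminate all values of \<open>f\<close>. What
  remains is a quadratic form in \<open>e\<close>, \<open>d\<close>, \<open>G\<close>; the parameters are chosen so that the only
  coefficients left are those of \<open>|G|\<^sup>2\<close> and \<open>|d|\<^sup>2\<close>, and both are nonpositive.\<close>

lemma energy_step_le: "energy (step x x') x \<le> (1 - t * s) * energy x x'"
proof -
  define y where "y = (1 + \<gamma>) *\<^sub>R x - \<gamma> *\<^sub>R x'"
  define x1 where "x1 = step x x'"
  define c where "c = t / \<alpha>"
  define e where "e = x - xs"
  define d where "d = x - x'"
  define G where "G = grad f y"
  define r where "r = t * s"
  have t: "t = c * \<alpha>" and \<mu>: "\<mu> = c * s\<^sup>2"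
    using \<alpha>_pos \<alpha>_\<mu> by (simp_all add: c_def field_simps)
  have "f x1 = f (y + ((\<beta> - \<gamma>) *\<^sub>R d - \<alpha> *\<^sub>R G))"
    by (rule arg_cong[of _ _ f]) (simp add: x1_def step_def y_def d_def G_def algebra_simps)
  also have "\<dots> \<le> f y + G \<bullet> ((\<beta> - \<gamma>) *\<^sub>R d - \<alpha> *\<^sub>R G)
      + L / 2 * (norm ((\<beta> - \<gamma>) *\<^sub>R d - \<alpha> *\<^sub>R G))\<^sup>2"
    unfolding G_def by (rule L_smooth_upper_bound[OF smooth])
  finally have f1: "f x1 \<le> \<dots>" .
  have "f y + G \<bullet> (- \<gamma> *\<^sub>R d) + \<mu> / 2 * (norm (- \<gamma> *\<^sub>R d))\<^sup>2 \<le> f (y + (- \<gamma> *\<^sub>R d))"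
    unfolding G_def by (rule strongly_convex_lower_bound[OF smooth strongly_convex])
  also have "\<dots> = f x"
    by (rule arg_cong[of _ _ f]) (simp add: y_def d_def algebra_simps)
  finally have f2: "\<dots> \<ge> f y + G \<bullet> (- \<gamma> *\<^sub>R d) + \<mu> / 2 * (norm (- \<gamma> *\<^sub>R d))\<^sup>2" .
  have "f y + G \<bullet> (- (e + \<gamma> *\<^sub>R d)) + \<mu> / 2 * (norm (- (e + \<gamma> *\<^sub>R d)))\<^sup>2 \<le> f (y + (- (e + \<gamma> *\<^sub>R d)))"
    unfolding G_def by (rule strongly_convex_lower_bound[OF smooth strongly_convex])
  also have "\<dots> = f xs"
    by (rule arg_cong[of _ _ f]) (simp add: y_def d_def e_def algebra_simps)
  finally have f3: "\<dots> \<ge> f y + G \<bullet> (- (e + \<gamma> *\<^sub>R d)) + \<mu> / 2 * (norm (- (e + \<gamma> *\<^sub>R d)))\<^sup>2" .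
  have E1: "energy x1 x = c / 2 * (norm (\<beta> *\<^sub>R d - \<alpha> *\<^sub>R G + s *\<^sub>R e))\<^sup>2 + (f x1 - f xs)"
    by (simp add: energy_def c_def x1_def step_def y_def d_def e_def G_def algebra_simps)
  have E0: "energy x x' = c / 2 * (norm ((1 - s) *\<^sub>R d + s *\<^sub>R e))\<^sup>2 + (f x - f xs)"
    by (simp add: energy_def c_def d_def e_def algebra_simps)
  have K1: "c * s\<^sup>2 / 2 - (1 - r) * c * s\<^sup>2 / 2 - r * \<mu> / 2 = 0"
    by (simp add: \<mu> field_simps)
  have K2: "- c * \<alpha> * s + r = 0" by (simp add: t r_def)
  have K4: "c * s * \<beta> - (1 - r) * c * s * (1 - s) - r * \<mu> * \<gamma> = 0"
    using momentum unfolding extrapolation \<mu> r_def t by (simp add: algebra_simps power2_eq_square) algebra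
  have K5: "- c * \<alpha> * \<beta> + (\<beta> - \<gamma>) - L * \<alpha> * (\<beta> - \<gamma>) + \<gamma> = 0"
    using stepsize unfolding extrapolation t by algebra
  have K3: "c * \<alpha>\<^sup>2 / 2 - \<alpha> + L * \<alpha>\<^sup>2 / 2 \<le> 0"
  proof -
    have "c * \<alpha>\<^sup>2 / 2 - \<alpha> + L * \<alpha>\<^sup>2 / 2 = \<alpha> / 2 * (t + \<alpha> * L - 2)"
      by (simp add: t field_simps power2_eq_square)
    also have "\<dots> \<le> 0" using \<alpha>_pos stepsize_le by (intro mult_nonneg_nonpos) auto
    finally show ?thesis .
  qed
  have K6: "c * \<beta>\<^sup>2 / 2 - (1 - r) * c * (1 - s)\<^sup>2 / 2 + L * (\<beta> - \<gamma>)\<^sup>2 / 2 - \<mu> * \<gamma>\<^sup>2 / 2 \<le> 0"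
    (is "?K6 \<le> 0")
  proof -
    have "?K6 * (2 * \<alpha>)
      = \<beta>\<^sup>2 * (t + \<alpha> * L * (1 - \<psi>)\<^sup>2 - \<alpha> * \<mu> * \<psi>\<^sup>2) - t * ((1 - t * s) * (1 - s)\<^sup>2)"
      unfolding extrapolation r_def t by (simp add: field_simps power2_eq_square)
    also have "\<dots> \<le> 0" using momentum_le by simp
    finally show ?thesis using \<alpha>_pos by (simp add: mult_le_0_iff)
  qed
  have "energy x1 x - (1 - r) * energy x x'
    \<le> c / 2 * (norm (\<beta> *\<^sub>R d - \<alpha> *\<^sub>R G + s *\<^sub>R e))\<^sup>2
      - (1 - r) * (c / 2 * (norm ((1 - s) *\<^sub>R d + s *\<^sub>R e))\<^sup>2)
      + (G \<bullet> ((\<beta> - \<gamma>) *\<^sub>R d - \<alpha> *\<^sub>R G) + L / 2 * (norm ((\<beta> - \<gamma>) *\<^sub>R d - \<alpha> *\<^sub>R G))\<^sup>2)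
      - (1 - r) * (G \<bullet> (- \<gamma> *\<^sub>R d) + \<mu> / 2 * (norm (- \<gamma> *\<^sub>R d))\<^sup>2)
      - r * (G \<bullet> (- (e + \<gamma> *\<^sub>R d)) + \<mu> / 2 * (norm (- (e + \<gamma> *\<^sub>R d)))\<^sup>2)"
  proof -
    have "(1 - r) * (f y + G \<bullet> (- \<gamma> *\<^sub>R d) + \<mu> / 2 * (norm (- \<gamma> *\<^sub>R d))\<^sup>2) \<le> (1 - r) * f x"
      using f2 ts_less_1 by (intro mult_left_mono) (auto simp: r_def)
    moreover have "r * (f y + G \<bullet> (- (e + \<gamma> *\<^sub>R d)) + \<mu> / 2 * (norm (- (e + \<gamma> *\<^sub>R d)))\<^sup>2) \<le> r * f xs"
      using f3 t_pos s_pos by (intro mult_left_mono) (auto simp: r_def)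
    ultimately show ?thesis
      using f1 unfolding E1 E0 by (simp add: algebra_simps)
  qed
  also have "\<dots> = (c * s\<^sup>2 / 2 - (1 - r) * c * s\<^sup>2 / 2 - r * \<mu> / 2) * (e \<bullet> e)
     + (- c * \<alpha> * s + r) * (e \<bullet> G)
     + (c * \<alpha>\<^sup>2 / 2 - \<alpha> + L * \<alpha>\<^sup>2 / 2) * (G \<bullet> G)
     + (c * s * \<beta> - (1 - r) * c * s * (1 - s) - r * \<mu> * \<gamma>) * (e \<bullet> d)
     + (- c * \<alpha> * \<beta> + (\<beta> - \<gamma>) - L * \<alpha> * (\<beta> - \<gamma>) + \<gamma>) * (d \<bullet> G)
     + ?K6 * (d \<bullet> d)"
    unfolding power2_norm_eq_inner
    by (simp add: inner_add_left inner_add_right inner_diff_left inner_diff_right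
        inner_commute[of G e] inner_commute[of d e] inner_commute[of G d])
      (simp add: field_simps power2_eq_square)
  also have "\<dots> \<le> 0"
    using mult_nonpos_nonneg[OF K3 inner_ge_zero[of G]] mult_nonpos_nonneg[OF K6 inner_ge_zero[of d]]
    unfolding K1 K2 K4 K5 by linarith
  finally show ?thesis by (simp add: r_def x1_def)
qed


text \<open>The quadratic part of the energy expands exactly; for \<open>f\<close> the descent inequality is used.\<close>

lemma energy_add_noise_le:
  "energy (x1 - \<alpha> *\<^sub>R w) x
    \<le> energy x1 x - noise_direction x1 x \<bullet> w + \<alpha> / 2 * (t + \<alpha> * L) * (norm w)\<^sup>2"
proof -
  define u where "u = x1 - x + s *\<^sub>R (x - xs)"
  have "f (x1 + (- \<alpha> *\<^sub>R w)) \<le> f x1 + grad f x1 \<bullet> (- \<alpha> *\<^sub>R w) + L / 2 * (norm (- \<alpha> *\<^sub>R w))\<^sup>2"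
    by (rule L_smooth_upper_bound[OF smooth])
  then have gap: "f (x1 - \<alpha> *\<^sub>R w) \<le> f x1 - \<alpha> * (grad f x1 \<bullet> w) + L / 2 * \<alpha>\<^sup>2 * (norm w)\<^sup>2"
    by (simp add: power_mult_distrib)
  have pos: "t / (2 * \<alpha>) * (norm ((x1 - \<alpha> *\<^sub>R w) - x + s *\<^sub>R (x - xs)))\<^sup>2
    = t / (2 * \<alpha>) * (norm u)\<^sup>2 - t * (u \<bullet> w) + \<alpha> / 2 * t * (norm w)\<^sup>2"
  proof -
    have eq: "(x1 - \<alpha> *\<^sub>R w) - x + s *\<^sub>R (x - xs) = u - \<alpha> *\<^sub>R w" by (simp add: u_def)
    have nrm: "(norm (u - \<alpha> *\<^sub>R w))\<^sup>2 = (norm u)\<^sup>2 - 2 * \<alpha> * (u \<bullet> w) + \<alpha>\<^sup>2 * (norm w)\<^sup>2"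
      by (simp add: power2_norm_eq_inner inner_diff_left inner_diff_right inner_commute[of w u])
        (simp add: power2_eq_square algebra_simps)
    show ?thesis
      unfolding eq nrm using \<alpha>_pos by (simp add: field_simps power2_eq_square)
  qed
  have "energy (x1 - \<alpha> *\<^sub>R w) x = t / (2 * \<alpha>) * (norm u)\<^sup>2 - t * (u \<bullet> w) + \<alpha> / 2 * t * (norm w)\<^sup>2
      + (f (x1 - \<alpha> *\<^sub>R w) - f xs)"
    by (simp only: energy_def pos)
  moreover have "energy x1 x = t / (2 * \<alpha>) * (norm u)\<^sup>2 + (f x1 - f xs)"
    by (simp add: energy_def u_def)
  moreover have "noise_direction x1 x \<bullet> w = \<alpha> * (grad f x1 \<bullet> w) + t * (u \<bullet> w)"
    by (simp add: noise_direction_def u_def inner_add_left)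
  moreover have "\<alpha> / 2 * (t + \<alpha> * L) * (norm w)\<^sup>2 = \<alpha> / 2 * t * (norm w)\<^sup>2 + L / 2 * \<alpha>\<^sup>2 * (norm w)\<^sup>2"
    by (simp add: algebra_simps power2_eq_square)
  ultimately show ?thesis using gap by linarith
qed

text \<open>The gradient at \<open>x1\<close> is controlled by the gap \<open>f x1 - f xs\<close> and the other summand by the
  quadratic part of the energy. Hence the energy of the noiseless successor alone bounds the
  linear noise term, whatever the conditioning of \<open>f\<close>. The weights in the Cauchy--Schwarz
  inequality are those for which both parts carry the common factor \<open>t + \<alpha> L\<close>.\<close>

lemma norm_noise_direction_le:
  "(norm (noise_direction x1 x))\<^sup>2 \<le> 2 * \<alpha> * (t + \<alpha> * L) * energy x1 x"
proof -
  define u where "u = x1 - x + s *\<^sub>R (x - xs)"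
  define N where "N = norm (grad f x1)"
  define U where "U = norm u"
  have "norm (\<alpha> *\<^sub>R grad f x1 + t *\<^sub>R u) \<le> \<alpha> * N + t * U"
    unfolding N_def U_def using \<alpha>_pos t_pos by (intro norm_triangle_le) simp
  then have "(norm (\<alpha> *\<^sub>R grad f x1 + t *\<^sub>R u))\<^sup>2 \<le> (\<alpha> * N + t * U)\<^sup>2"
    by (intro power_mono) auto
  also have "\<dots> \<le> (t + \<alpha> * L) * (\<alpha> / L * N\<^sup>2 + t * U\<^sup>2)"
  proof -
    have "(t + \<alpha> * L) * (\<alpha> / L * N\<^sup>2 + t * U\<^sup>2) - (\<alpha> * N + t * U)\<^sup>2 = t * \<alpha> / L * (N - L * U)\<^sup>2"
      using L_pos by (simp add: field_simps power2_eq_square)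
    moreover have "\<dots> \<ge> 0" using t_pos \<alpha>_pos L_pos by simp
    ultimately show ?thesis by linarith
  qed
  also have "\<dots> \<le> (t + \<alpha> * L) * (2 * \<alpha> * (f x1 - f xs) + t * U\<^sup>2)"
  proof -
    have "\<alpha> / L * N\<^sup>2 \<le> \<alpha> / L * (2 * L * (f x1 - f xs))"
      unfolding N_def using norm_grad_le_gap[OF smooth L_pos minimizer] \<alpha>_pos L_pos by (intro mult_left_mono) auto
    also have "\<dots> = 2 * \<alpha> * (f x1 - f xs)" using L_pos by simp
    finally show ?thesis using t_pos \<alpha>_pos L_pos by (intro mult_left_mono add_right_mono) auto
  qed
  also have "\<dots> = 2 * \<alpha> * (t + \<alpha> * L) * energy x1 x"
    using \<alpha>_pos by (simp add: energy_def noise_direction_def U_def u_def field_simps)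
  finally show ?thesis by (simp add: u_def noise_direction_def)
qed


text \<open>The factor \<open>2 / D\<close> collects two effects of the Gaussian integral: the energy \<open>V1\<close> of the
  noiseless successor itself, and \<open>(2 - D) / D\<close> times \<open>V1\<close> from the squared norm of the noise
  direction. The dimension enters through the normalising factor \<open>(2 / D) ^ (d / 2)\<close>, which the
  inequality \<open>1 + u \<le> exp u\<close> turns into an exponential.\<close>

lemma expected_exp_energy_step_le:
  assumes \<sigma>: "0 < \<sigma>" and \<theta>: "0 < \<theta>"
    and D: "D = 2 - \<theta> * \<alpha> * (t + \<alpha> * L)" "0 < D"
    and \<tau>: "\<tau> = \<theta> / (2 * \<sigma>\<^sup>2)"
  shows "(\<integral>\<^sup>+ v. ennreal (gaussian_density \<sigma> v) * ennreal (exp (\<tau> * energy (step x x' - \<alpha> *\<^sub>R v) x)) \<partial>lborel)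
    \<le> ennreal (exp (\<tau> * (\<sigma>\<^sup>2 * real CARD('d) * \<alpha> * (t + \<alpha> * L) / D
                        + 2 * (1 - t * s) / D * energy x x')))"
proof -
  define V1 where "V1 = energy (step x x') x"
  define g where "g = noise_direction (step x x') x"
  define b where "b = \<tau> * (\<alpha> / 2 * (t + \<alpha> * L))"
  have \<tau>0: "0 < \<tau>" using \<sigma> \<theta> by (simp add: \<tau>)
  \<comment> \<open>So \<open>D > 0\<close> is exactly the condition for the Gaussian integral to converge.\<close>
  have bD: "1 - 2 * b * \<sigma>\<^sup>2 = D / 2"
    using \<sigma> by (simp add: b_def \<tau> D(1) field_simps)
  have pw: "\<tau> * energy (step x x' - \<alpha> *\<^sub>R v) x \<le> \<tau> * V1 + ((- \<tau> *\<^sub>R g) \<bullet> v + b * (norm v)\<^sup>2)" for v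
  proof -
    have "\<tau> * energy (step x x' - \<alpha> *\<^sub>R v) x
        \<le> \<tau> * (V1 - g \<bullet> v + \<alpha> / 2 * (t + \<alpha> * L) * (norm v)\<^sup>2)"
      using energy_add_noise_le \<tau>0 unfolding V1_def g_def by (intro mult_left_mono) auto
    then show ?thesis by (simp add: b_def algebra_simps)
  qed
  have "(\<integral>\<^sup>+ v. ennreal (gaussian_density \<sigma> v) * ennreal (exp (\<tau> * energy (step x x' - \<alpha> *\<^sub>R v) x)) \<partial>lborel)
      \<le> (\<integral>\<^sup>+ v. ennreal (exp (\<tau> * V1)) * (ennreal (gaussian_density \<sigma> v)
            * ennreal (exp ((- \<tau> *\<^sub>R g) \<bullet> v + b * (norm v)\<^sup>2))) \<partial>lborel)"
  proof (rule nn_integral_mono)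
    fix v
    have "ennreal (exp (\<tau> * energy (step x x' - \<alpha> *\<^sub>R v) x))
        \<le> ennreal (exp (\<tau> * V1)) * ennreal (exp ((- \<tau> *\<^sub>R g) \<bullet> v + b * (norm v)\<^sup>2))"
      unfolding ennreal_mult''[OF exp_ge_zero, symmetric] exp_add[symmetric] using pw[of v]
      by (simp add: ennreal_leI)
    then show "ennreal (gaussian_density \<sigma> v) * ennreal (exp (\<tau> * energy (step x x' - \<alpha> *\<^sub>R v) x))
        \<le> ennreal (exp (\<tau> * V1)) * (ennreal (gaussian_density \<sigma> v)
            * ennreal (exp ((- \<tau> *\<^sub>R g) \<bullet> v + b * (norm v)\<^sup>2)))"
      by (simp add: mult.left_commute mult_left_mono)
  qed
  also have "\<dots> = ennreal (exp (\<tau> * V1)) * ennreal ((1 / sqrt (D / 2)) ^ CARD('d)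
      * exp (\<sigma>\<^sup>2 * (norm (- \<tau> *\<^sub>R g))\<^sup>2 / (2 * (D / 2))))"
  proof -
    have "(\<lambda>v. ennreal (gaussian_density \<sigma> v) * ennreal (exp ((- \<tau> *\<^sub>R g) \<bullet> v + b * (norm v)\<^sup>2)))
        \<in> borel_measurable lborel"
      unfolding gaussian_density_def by measurable
    moreover have "2 * b * \<sigma>\<^sup>2 < 1" using bD D(2) by linarith
    ultimately show ?thesis
      using nn_integral_gaussian_exp_quadratic[OF \<sigma>, of b "- \<tau> *\<^sub>R g"]
      by (simp only: nn_integral_cmult bD)
  qed
  also have "\<dots> = ennreal (exp (\<tau> * V1) * ((1 / sqrt (D / 2)) ^ CARD('d)
      * exp (\<sigma>\<^sup>2 * (norm (- \<tau> *\<^sub>R g))\<^sup>2 / (2 * (D / 2)))))"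
    using D(2) by (intro ennreal_mult[symmetric]) auto
  also have "\<dots> \<le> ennreal (exp (\<tau> * V1) * (exp (\<tau> * (\<sigma>\<^sup>2 * real CARD('d) * \<alpha> * (t + \<alpha> * L) / D))
      * exp (\<tau> * (2 / D - 1) * V1)))"
  proof (intro ennreal_leI mult_left_mono mult_mono)
    have "1 / sqrt (D / 2) = sqrt (2 / D)" by (simp add: real_sqrt_divide)
    also have "\<dots> \<le> sqrt (exp (2 / D - 1))"
      using exp_ge_add_one_self[of "2 / D - 1"] by (intro real_sqrt_le_mono) simp
    also have "\<dots> = exp ((2 / D - 1) / 2)"
      by (rule real_sqrt_unique) (simp_all add: exp_double[symmetric])
    finally have "(1 / sqrt (D / 2)) ^ CARD('d) \<le> exp ((2 / D - 1) / 2) ^ CARD('d)"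
      using D(2) by (intro power_mono) auto
    also have "\<dots> = exp (\<tau> * (\<sigma>\<^sup>2 * real CARD('d) * \<alpha> * (t + \<alpha> * L) / D))"
    proof -
      have "2 / D - 1 = \<theta> * \<alpha> * (t + \<alpha> * L) / D" using D by (simp add: field_simps)
      then show ?thesis
        unfolding exp_of_nat_mult[symmetric] using \<sigma> by (simp add: \<tau> mult_ac)
    qed
    finally show "(1 / sqrt (D / 2)) ^ CARD('d) \<le> exp (\<tau> * (\<sigma>\<^sup>2 * real CARD('d) * \<alpha> * (t + \<alpha> * L) / D))" .
    have "\<sigma>\<^sup>2 * (norm (- \<tau> *\<^sub>R g))\<^sup>2 / (2 * (D / 2)) = \<sigma>\<^sup>2 * \<tau>\<^sup>2 / D * (norm g)\<^sup>2"
      by (simp add: power_mult_distrib)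
    also have "\<dots> \<le> \<sigma>\<^sup>2 * \<tau>\<^sup>2 / D * (2 * \<alpha> * (t + \<alpha> * L) * V1)"
      unfolding g_def V1_def using D(2) by (intro mult_left_mono norm_noise_direction_le) auto
    also have "\<dots> = \<tau> * (\<sigma>\<^sup>2 * \<tau> * 2 * (\<alpha> * (t + \<alpha> * L)) / D) * V1"
      by (simp add: power2_eq_square)
    also have "\<sigma>\<^sup>2 * \<tau> * 2 = \<theta>" using \<sigma> by (simp add: \<tau>)
    also have "\<theta> * (\<alpha> * (t + \<alpha> * L)) / D = 2 / D - 1" using D by (simp add: field_simps)
    finally show "exp (\<sigma>\<^sup>2 * (norm (- \<tau> *\<^sub>R g))\<^sup>2 / (2 * (D / 2))) \<le> exp (\<tau> * (2 / D - 1) * V1)"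
      by simp
  qed (use D in auto)
  also have "\<dots> = ennreal (exp (\<tau> * (\<sigma>\<^sup>2 * real CARD('d) * \<alpha> * (t + \<alpha> * L) / D + 2 / D * V1)))"
    unfolding exp_add[symmetric] by (simp add: algebra_simps)
  also have "\<dots> \<le> ennreal (exp (\<tau> * (\<sigma>\<^sup>2 * real CARD('d) * \<alpha> * (t + \<alpha> * L) / D
                        + 2 * (1 - t * s) / D * energy x x')))"
  proof -
    have "2 / D * V1 \<le> 2 / D * ((1 - t * s) * energy x x')"
      unfolding V1_def using D(2) by (intro mult_left_mono energy_step_le) auto
    also have "\<dots> = 2 * (1 - t * s) / D * energy x x'" by (simp only: times_divide_eq_left mult.assoc)
    finally show ?thesis using \<tau>0 by (intro ennreal_leI) simp
  qed
  finally show ?thesis .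
qed

end

section \<open>The exponential moments along the iteration\<close>

text \<open>Independence of \<open>W\<close> from a sub-\<open>\<sigma>\<close>-algebra makes the joint law with any variable \<open>X\<close>
  measurable for it a product, so the noise can be integrated out first.\<close>

lemma nn_integral_indep_density:
  fixes W :: "'w \<Rightarrow> 'b::euclidean_space"
  assumes M: "prob_space M"
    and W: "distributed M lborel W g"
    and indep: "prob_space.indep_set M {W -` A \<inter> space M | A. A \<in> sets borel} (sets N)"
    and N: "space N = space M"
    and X: "X \<in> measurable N S"
    and h: "h \<in> borel_measurable (S \<Otimes>\<^sub>M borel)"
  shows "(\<integral>\<^sup>+ \<omega>. h (X \<omega>, W \<omega>) \<partial>M) = (\<integral>\<^sup>+ \<omega>. \<integral>\<^sup>+ v. g v * h (X \<omega>, v) \<partial>lborel \<partial>M)"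
proof -
  interpret prob_space M by (rule M)
  have N_sub: "sets N \<subseteq> sets M"
    using indep unfolding indep_set_def indep_sets_def by (auto split: bool.splits)
  have Xm[measurable]: "X \<in> measurable M S"
    using X N N_sub by (auto simp: measurable_def)
  have Wm[measurable]: "W \<in> measurable M borel"
    using distributed_measurable[OF W] by simp
  note h[measurable]
  have gm[measurable]: "g \<in> borel_measurable lborel"
    using distributed_borel_measurable[OF W] .
  interpret dW: prob_space "distr M borel W" by (rule prob_space_distr) measurable
  interpret dX: prob_space "distr M S X" by (rule prob_space_distr) measurable
  have "(\<integral>\<^sup>+ \<omega>. h (X \<omega>, W \<omega>) \<partial>M) = (\<integral>\<^sup>+ z. h z \<partial>distr M (S \<Otimes>\<^sub>M borel) (\<lambda>\<omega>. (X \<omega>, W \<omega>)))"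
    by (subst nn_integral_distr) auto
  also have "distr M (S \<Otimes>\<^sub>M borel) (\<lambda>\<omega>. (X \<omega>, W \<omega>)) = distr M S X \<Otimes>\<^sub>M distr M borel W"
  proof (rule pair_measure_eqI[symmetric])
    fix A B assume A: "A \<in> sets (distr M S X)" and B: "B \<in> sets (distr M borel W)"
    have "X -` A \<inter> space M \<in> sets N"
      using A measurable_sets[OF X, of A] by (simp add: N)
    then have "prob ((W -` B \<inter> space M) \<inter> (X -` A \<inter> space M))
        = prob (W -` B \<inter> space M) * prob (X -` A \<inter> space M)"
      using B by (intro indep_setD[OF indep]) auto
    moreover have "(\<lambda>\<omega>. (X \<omega>, W \<omega>)) -` (A \<times> B) \<inter> space M = (W -` B \<inter> space M) \<inter> (X -` A \<inter> space M)"
      by auto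
    ultimately show "emeasure (distr M S X) A * emeasure (distr M borel W) B
        = emeasure (distr M (S \<Otimes>\<^sub>M borel) (\<lambda>\<omega>. (X \<omega>, W \<omega>))) (A \<times> B)"
      using A B by (simp add: emeasure_distr emeasure_eq_measure ennreal_mult' mult.commute)
  qed (auto intro: dX.sigma_finite_measure_axioms dW.sigma_finite_measure_axioms)
  also have "(\<integral>\<^sup>+ z. h z \<partial>(distr M S X \<Otimes>\<^sub>M distr M borel W))
      = (\<integral>\<^sup>+ x. \<integral>\<^sup>+ v. h (x, v) \<partial>distr M borel W \<partial>distr M S X)"
    by (rule dW.nn_integral_fst[symmetric]) simp
  also have "\<dots> = (\<integral>\<^sup>+ \<omega>. \<integral>\<^sup>+ v. h (X \<omega>, v) \<partial>distr M borel W \<partial>M)"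
    by (rule nn_integral_distr) measurable
  also have "\<dots> = (\<integral>\<^sup>+ \<omega>. \<integral>\<^sup>+ v. g v * h (X \<omega>, v) \<partial>lborel \<partial>M)"
  proof (rule nn_integral_cong)
    fix \<omega> assume "\<omega> \<in> space M"
    then have [measurable]: "(\<lambda>v. h (X \<omega>, v)) \<in> borel_measurable borel"
      using measurable_space[OF Xm] by measurable
    have "distr M borel W = distr M lborel W" by (rule distr_cong) auto
    also have "\<dots> = density lborel g" using W by (simp add: distributed_def)
    finally show "(\<integral>\<^sup>+ v. h (X \<omega>, v) \<partial>distr M borel W) = (\<integral>\<^sup>+ v. g v * h (X \<omega>, v) \<partial>lborel)"
      by (simp add: nn_integral_density)
  qed
  finally show ?thesis .
qed

lemma gmm_pair_eq:
  "gmm_pair f \<alpha> \<beta> \<gamma> x0 xm1 (\<lambda>j. w j \<omega>) k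
     = (gmm f \<alpha> \<beta> \<gamma> x0 xm1 w k \<omega>, case k of 0 \<Rightarrow> xm1 | Suc j \<Rightarrow> gmm f \<alpha> \<beta> \<gamma> x0 xm1 w j \<omega>)"
  by (cases k) (auto simp: gmm_def Let_def split: prod.splits)

context tuned_gmm
begin

lemma gmm_Suc:
  "gmm f \<alpha> \<beta> \<gamma> x0 xm1 w (Suc k) \<omega>
     = step (gmm f \<alpha> \<beta> \<gamma> x0 xm1 w k \<omega>) (case k of 0 \<Rightarrow> xm1 | Suc j \<Rightarrow> gmm f \<alpha> \<beta> \<gamma> x0 xm1 w j \<omega>)
       - \<alpha> *\<^sub>R w (Suc k) \<omega>"
  unfolding gmm_def[of _ _ _ _ _ _ _ "Suc k"] gmm_pair.simps(2)
  unfolding gmm_pair_eq by (simp add: step_def algebra_simps)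

lemma borel_measurable_f[measurable]: "f \<in> borel_measurable borel"
  using smooth
  by (intro borel_measurable_continuous_onI continuous_at_imp_continuous_on)
     (auto simp: L_smooth_def intro: differentiable_imp_continuous_within)

lemma borel_measurable_grad[measurable]: "grad f \<in> borel_measurable borel"
  using smooth
  by (intro borel_measurable_continuous_onI) (auto simp: L_smooth_def intro: lipschitz_on_continuous_on)

lemma measurable_energy[measurable]: "(\<lambda>z. energy (fst z) (snd z)) \<in> borel_measurable (borel \<Otimes>\<^sub>M borel)"
  unfolding energy_def by measurable

text \<open>Let \<open>R\<close> be the bound for the exponential rate after \<open>k\<close> steps. Integrating out the newest noise
  variable leaves the moment of order \<open>\<tau> \<rho>\<close> of the energy. Since \<open>\<rho> < 1\<close>, convexity of the
  exponential gives \<open>exp (\<rho> u) \<le> 1 - \<rho> + \<rho> exp u\<close>; with \<open>u = \<tau> (V - R)\<close> the right-hand side has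
  expectation at most \<open>1\<close>, whence the rates satisfy \<open>R' = b + \<rho> R\<close>. The claim states the
  solution of this recursion.\<close>

lemma exp_moment_energy_le:
  fixes x0 xm1 :: "real ^ 'd" and w :: "nat \<Rightarrow> 'w \<Rightarrow> real ^ 'd"
  defines "x \<equiv> gmm f \<alpha> \<beta> \<gamma> x0 xm1 w"
  defines "x' \<equiv> (\<lambda>k \<omega>. case k of 0 \<Rightarrow> xm1 | Suc j \<Rightarrow> x j \<omega>)"
  assumes M: "prob_space M" and noise: "gaussian_gradient_noise M \<sigma> w x"
    and \<sigma>: "0 < \<sigma>" and \<theta>: "0 < \<theta>"
    and D: "D = 2 - \<theta> * \<alpha> * (t + \<alpha> * L)" "0 < D"
    and \<tau>: "\<tau> = \<theta> / (2 * \<sigma>\<^sup>2)"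
    and \<rho>: "\<rho> = 2 * (1 - t * s) / D" "\<rho> < 1"
    and b: "b = \<sigma>\<^sup>2 * real CARD('d) * \<alpha> * (t + \<alpha> * L) / D"
  shows "(\<integral>\<^sup>+ \<omega>. ennreal (exp (\<tau> * energy (x k \<omega>) (x' k \<omega>))) \<partial>M)
    \<le> ennreal (exp (\<tau> * (\<rho> ^ k * energy x0 xm1 + (1 - \<rho> ^ k) / (1 - \<rho>) * b)))"
proof (induction k)
  case 0
  interpret prob_space M by (rule M)
  show ?case by (simp add: x_def x'_def gmm_def emeasure_space_1)
next
  case (Suc k)
  interpret prob_space M by (rule M)
  define R where "R = \<rho> ^ k * energy x0 xm1 + (1 - \<rho> ^ k) / (1 - \<rho>) * b"
  have \<rho>0: "0 \<le> \<rho>" using ts_less_1 D(2) by (simp add: \<rho>(1))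
  define N where "N = sigma (space M) (\<Union>i\<in>{..k}. {x i -` A \<inter> space M | A. A \<in> sets borel})"
  have gen: "(\<Union>i\<in>{..k}. {x i -` A \<inter> space M | A. A \<in> sets borel}) \<subseteq> Pow (space M)" by auto
  have N: "space N = space M" "sets N = generated_upto M x k"
    using gen by (auto simp: N_def generated_upto_def)
  have x_N: "x i \<in> borel_measurable N" if "i \<le> k" for i
  proof (rule measurableI)
    fix A :: "(real ^ 'd) set" assume "A \<in> sets borel"
    then show "x i -` A \<inter> space N \<in> sets N"
      unfolding N generated_upto_def using that by (intro sigma_sets.Basic) auto
  qed simp
  have X: "(\<lambda>\<omega>. (x k \<omega>, x' k \<omega>)) \<in> measurable N (borel \<Otimes>\<^sub>M borel)"
  proof (rule measurable_Pair)
    show "x' k \<in> borel_measurable N" using x_N by (cases k) (auto simp: x'_def)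
  qed (simp add: x_N)
  have W: "distributed M lborel (w (Suc k)) (\<lambda>v. ennreal (gaussian_density \<sigma> v))"
    and indep: "indep_set {w (Suc k) -` A \<inter> space M | A. A \<in> sets borel} (sets N)"
    using noise unfolding gaussian_gradient_noise_def N by auto
  have N_sub: "sets N \<subseteq> sets M"
    using indep unfolding indep_set_def indep_sets_def by (auto split: bool.splits)
  have Xm[measurable]: "(\<lambda>\<omega>. (x k \<omega>, x' k \<omega>)) \<in> measurable M (borel \<Otimes>\<^sub>M borel)"
    using X N N_sub by (auto simp: measurable_def)
  have Vm[measurable]: "(\<lambda>\<omega>. energy (x k \<omega>) (x' k \<omega>)) \<in> borel_measurable M"
    using measurable_compose[OF Xm measurable_energy] by simp
  define h where "h = (\<lambda>(z, v). ennreal (exp (\<tau> * energy (step (fst z) (snd z) - \<alpha> *\<^sub>R v) (fst z))))"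
  have h: "h \<in> borel_measurable ((borel \<Otimes>\<^sub>M borel) \<Otimes>\<^sub>M borel)"
    unfolding h_def energy_def step_def by measurable
  have "(\<integral>\<^sup>+ \<omega>. ennreal (exp (\<tau> * energy (x (Suc k) \<omega>) (x' (Suc k) \<omega>))) \<partial>M)
      = (\<integral>\<^sup>+ \<omega>. h ((x k \<omega>, x' k \<omega>), w (Suc k) \<omega>) \<partial>M)"
    unfolding h_def x'_def x_def by (simp add: gmm_Suc)
  also have "\<dots> = (\<integral>\<^sup>+ \<omega>. \<integral>\<^sup>+ v. ennreal (gaussian_density \<sigma> v) * h ((x k \<omega>, x' k \<omega>), v) \<partial>lborel \<partial>M)"
    by (rule nn_integral_indep_density[OF M W indep N(1) X h])
  also have "\<dots> \<le> (\<integral>\<^sup>+ \<omega>. ennreal (exp (\<tau> * (b + \<rho> * energy (x k \<omega>) (x' k \<omega>)))) \<partial>M)"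
    unfolding h_def b \<rho>(1)
    using expected_exp_energy_step_le[OF \<sigma> \<theta> D \<tau>] by (intro nn_integral_mono) (simp only: prod.case fst_conv snd_conv)
  also have "\<dots> \<le> (\<integral>\<^sup>+ \<omega>. ennreal (exp (\<tau> * (b + \<rho> * R))) * (ennreal (1 - \<rho>)
      + ennreal (\<rho> * exp (- \<tau> * R)) * ennreal (exp (\<tau> * energy (x k \<omega>) (x' k \<omega>)))) \<partial>M)"
  proof (rule nn_integral_mono)
    fix \<omega>
    \<comment> \<open>The deviation from the bound \<open>R\<close>, normalised so that its exponential has mean at most \<open>1\<close>.\<close>
    define u where "u = \<tau> * (energy (x k \<omega>) (x' k \<omega>) - R)"
    have "exp (\<rho> * u) \<le> (1 - \<rho>) + \<rho> * exp u"
      using convex_onD[OF exp_convex, of \<rho> 0 u] \<rho>0 \<rho>(2) by simp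
    then have "exp (\<tau> * (b + \<rho> * R)) * exp (\<rho> * u) \<le> exp (\<tau> * (b + \<rho> * R)) * ((1 - \<rho>) + \<rho> * exp u)"
      by (intro mult_left_mono) auto
    also have "exp (\<tau> * (b + \<rho> * R)) * exp (\<rho> * u) = exp (\<tau> * (b + \<rho> * energy (x k \<omega>) (x' k \<omega>)))"
      unfolding exp_add[symmetric] by (simp add: u_def algebra_simps)
    also have "exp u = exp (- \<tau> * R) * exp (\<tau> * energy (x k \<omega>) (x' k \<omega>))"
      unfolding exp_add[symmetric] by (simp add: u_def algebra_simps)
    finally have "ennreal (exp (\<tau> * (b + \<rho> * energy (x k \<omega>) (x' k \<omega>)))) \<le>
      ennreal (exp (\<tau> * (b + \<rho> * R)) * ((1 - \<rho>) + \<rho> * exp (- \<tau> * R) * exp (\<tau> * energy (x k \<omega>) (x' k \<omega>))))"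
      by (intro ennreal_leI) (simp add: mult.assoc)
    also have "\<dots> = ennreal (exp (\<tau> * (b + \<rho> * R))) * (ennreal (1 - \<rho>)
      + ennreal (\<rho> * exp (- \<tau> * R)) * ennreal (exp (\<tau> * energy (x k \<omega>) (x' k \<omega>))))"
      using \<rho>0 \<rho>(2) by (simp add: ennreal_mult ennreal_plus)
    finally show "ennreal (exp (\<tau> * (b + \<rho> * energy (x k \<omega>) (x' k \<omega>)))) \<le> \<dots>" .
  qed
  also have "\<dots> = ennreal (exp (\<tau> * (b + \<rho> * R))) * (ennreal (1 - \<rho>)
      + ennreal (\<rho> * exp (- \<tau> * R)) * (\<integral>\<^sup>+ \<omega>. ennreal (exp (\<tau> * energy (x k \<omega>) (x' k \<omega>))) \<partial>M))"
    by (simp add: nn_integral_cmult nn_integral_add emeasure_space_1)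
  also have "\<dots> \<le> ennreal (exp (\<tau> * (b + \<rho> * R))) * (ennreal (1 - \<rho>)
      + ennreal (\<rho> * exp (- \<tau> * R)) * ennreal (exp (\<tau> * R)))"
    using Suc.IH unfolding R_def[symmetric] by (intro mult_left_mono add_left_mono) auto
  also have "\<dots> = ennreal (exp (\<tau> * (b + \<rho> * R)))"
    using \<rho>0 \<rho>(2)
    by (simp add: ennreal_mult[symmetric] ennreal_plus[symmetric] mult.assoc exp_add[symmetric] del: ennreal_plus)
  also have "b + \<rho> * R = \<rho> ^ Suc k * energy x0 xm1 + (1 - \<rho> ^ Suc k) / (1 - \<rho>) * b"
    using \<rho>(2) by (simp add: R_def field_simps)
  finally show ?case .
qed

end

section \<open>Parameter estimates\<close>

text \<open>With \<open>h = 1 / \<vartheta>\<close>, \<open>\<epsilon> = 1 - \<psi>\<close> and \<open>s = sqrt (\<alpha> \<mu> / \<vartheta>)\<close> the conclusion is the strict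
  reverse of the inequality that defines \<open>S_one\<close>, multiplied by \<open>h\<^sup>2\<close>. The first hypothesis on \<open>\<epsilon>\<close>
  restates \<open>\<vartheta> \<ge> 2 - 1 / \<psi>\<close>. For fixed \<open>h\<close> and \<open>s\<close> the difference \<open>K\<close> of the two sides is a
  concave quadratic in \<open>\<epsilon>\<close>, so it is enough that it is positive at both ends of the admissible
  interval. At the lower end \<open>e0\<close> it factors, with a factor that is positive because
  \<open>s (h - s) \<le> h - 1 < (h - 1)\<^sup>2\<close>; this is where \<open>h > 2\<close> is used.\<close>

lemma S_one_violated_beyond_ratio:
  fixes h \<epsilon> s :: real
  assumes h: "2 < h" and \<epsilon>: "h - 1 \<le> \<epsilon> * (2 * h - 1)" "\<epsilon> \<le> 1" and s: "0 < s" "s \<le> 1"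
  shows "(h - s\<^sup>2 * (1 - \<epsilon>))\<^sup>2 < h * (h - s) * (1 + \<epsilon> * (h - 1) - s\<^sup>2 * (1 - \<epsilon>)\<^sup>2)"
proof -
  define K where "K e = h * (h - s) * (1 + e * (h - 1) - s\<^sup>2 * (1 - e)\<^sup>2) - (h - s\<^sup>2 * (1 - e))\<^sup>2" for e
  \<comment> \<open>The least \<open>\<epsilon>\<close> permitted by the first hypothesis on \<open>\<epsilon>\<close>.\<close>
  define e0 where "e0 = (h - 1) / (2 * h - 1)"
  have e0: "e0 \<le> \<epsilon>" "e0 < 1" using h \<epsilon> by (simp_all add: e0_def field_simps)
  have K1: "0 < K 1"
  proof -
    have "K 1 = h\<^sup>2 * (h - s - 1)" by (simp add: K_def algebra_simps power2_eq_square)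
    then show ?thesis using h s by simp
  qed
  have K0: "0 < K e0"
  proof -
    define q where "q = 2 * h - 1"
    have q: "q \<noteq> 0" "0 < q" "1 - e0 = h / q" "1 + e0 * (h - 1) = h\<^sup>2 / q"
      using h by (auto simp: q_def e0_def field_simps power2_eq_square)
    have "0 < (h - 1)\<^sup>2 - s * (h - s)"
    proof -
      have "(1 - s) * (h - 1 - s) \<ge> 0" using s h by (intro mult_nonneg_nonneg) auto
      then have "s * (h - s) \<le> h - 1" by (simp add: algebra_simps)
      also have "\<dots> < (h - 1) * (h - 1)" using h by simp
      finally show ?thesis by (simp add: power2_eq_square)
    qed
    also have "(h - 1)\<^sup>2 - s * (h - s) = h * (h - s) - (q - s\<^sup>2)"
      by (simp add: q_def algebra_simps power2_eq_square)
    finally have *: "0 < h * (h - s) - (q - s\<^sup>2)" .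
    have qs: "0 < q - s\<^sup>2"
      using s h power_le_one[of s 2] by (simp add: q_def)
    have "K e0 = h\<^sup>2 / q\<^sup>2 * ((q - s\<^sup>2) * (h * (h - s) - (q - s\<^sup>2)))"
      unfolding K_def q(3,4) using q(1) by (simp add: field_simps power2_eq_square)
    then show ?thesis using * qs q(2) h by simp
  qed
  \<comment> \<open>The position of \<open>\<epsilon>\<close> between the two ends; the exact difference below expresses concavity.\<close>
  define u where "u = (\<epsilon> - e0) / (1 - e0)"
  have u: "0 \<le> u" "u \<le> 1" "\<epsilon> = (1 - u) * e0 + u * 1"
  proof -
    have "u * (1 - e0) = \<epsilon> - e0" using e0 by (simp add: u_def)
    then show "\<epsilon> = (1 - u) * e0 + u * 1" by (simp add: algebra_simps)
  qed (use e0 \<epsilon>(2) in \<open>auto simp: u_def\<close>)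
  have "K \<epsilon> - ((1 - u) * K e0 + u * K 1) = (h * (h - s) * s\<^sup>2 + s ^ 4) * (u * (1 - u) * (1 - e0)\<^sup>2)"
    unfolding u(3) K_def by (simp add: algebra_simps power2_eq_square power4_eq_xxxx)
  moreover have "\<dots> \<ge> 0" using h s u by (intro mult_nonneg_nonneg add_nonneg_nonneg) auto
  moreover have "0 < (1 - u) * K e0 + u * K 1"
  proof (cases "u = 0")
    case False
    then show ?thesis using K0 K1 u by (intro add_nonneg_pos) auto
  qed (use K0 in simp)
  ultimately have "0 < K \<epsilon>" by linarith
  then show ?thesis by (simp add: K_def)
qed

text \<open>The bounds on \<open>\<vartheta> s\<close>, \<open>\<alpha> \<psi> \<mu>\<close> and \<open>\<vartheta> + \<alpha> L\<close> reduce to \<open>\<psi> \<alpha> L \<le> 1\<close>, which for \<open>S_plus\<close> and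
  \<open>S_minus\<close> restates the bound by \<open>2 - 1 / \<psi>\<close>. The last inequality is that of \<open>S_one\<close> multiplied by
  \<open>\<vartheta>\<close>. The bound \<open>\<alpha> L \<le> 3 \<vartheta>\<close> limits how strongly noise in the
  objective gap can outweigh noise in the quadratic part of the energy, and on \<open>S_minus\<close> it is a
  consequence of \<open>S_one\<close>: if \<open>q = \<alpha> L / \<vartheta>\<close> exceeds \<open>3\<close>, then \<open>h = 1 / \<vartheta> = 1 + (1 - \<psi>) q\<close> exceeds
  \<open>2\<close>, and \<open>S_one_violated_beyond_ratio\<close> applies.\<close>

lemma admissible_parameters:
  fixes \<mu> L vt \<psi> \<alpha> :: real
  assumes \<mu>: "0 < \<mu>" and L: "\<mu> < L"
    and S: "(vt, \<psi>) \<in> S_zero \<union> S_c \<mu> L" and \<alpha>: "gmm_stepsize \<mu> L vt \<psi> \<alpha>"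
  defines "s \<equiv> sqrt (\<alpha> * \<mu> / vt)"
  shows "0 < \<alpha>" "0 < vt" "0 < s" "\<alpha> * \<mu> = vt * s\<^sup>2" "sqrt (vt * \<alpha> * \<mu>) = vt * s" "vt * s < 1"
    "\<alpha> * \<psi> * \<mu> < 1" "\<alpha> * L * (1 - \<psi>) = 1 - vt" "vt + \<alpha> * L \<le> 2" "\<alpha> * L \<le> 3 * vt"
    "(1 - vt * s) * (vt + \<alpha> * L * (1 - \<psi>)\<^sup>2 - \<alpha> * \<mu> * \<psi>\<^sup>2) \<le> vt * (1 - \<alpha> * \<psi> * \<mu>)\<^sup>2"
proof -
  have L0: "0 < L" using \<mu> L by simp
  have conv: "0 < s \<and> \<alpha> * \<mu> = vt * s\<^sup>2 \<and> sqrt (vt * \<alpha> * \<mu>) = vt * s" if "0 < \<alpha>" "0 < vt"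
  proof -
    have s2: "s\<^sup>2 = \<alpha> * \<mu> / vt" and s: "0 < s" using that \<mu> by (auto simp: s_def)
    then have eq: "\<alpha> * \<mu> = vt * s\<^sup>2" using that by simp
    have "vt * \<alpha> * \<mu> = (vt * s)\<^sup>2" by (simp add: eq power_mult_distrib power2_eq_square mult.assoc)
    then have "sqrt (vt * \<alpha> * \<mu>) = vt * s" using s that by simp
    with eq s show ?thesis by simp
  qed
  have reduce: "0 < \<alpha> \<and> 0 < vt \<and> vt * s < 1 \<and> \<alpha> * \<psi> * \<mu> < 1 \<and> \<alpha> * L * (1 - \<psi>) = 1 - vt \<and> vt + \<alpha> * L \<le> 2"
    if \<alpha>0: "0 < \<alpha>" and vt: "0 < vt" and \<psi>: "0 \<le> \<psi>" "\<psi> * (\<alpha> * L) \<le> 1"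
      and st: "\<alpha> * L * (1 - \<psi>) = 1 - vt"
  proof -
    have le2: "vt + \<alpha> * L \<le> 2" using st \<psi>(2) by (simp add: algebra_simps)
    \<comment> \<open>By the inequality of arithmetic and geometric means, \<open>\<vartheta> \<alpha> L \<le> 1\<close>, and \<open>\<mu> < L\<close> makes it strict.\<close>
    have "vt * (\<alpha> * L) \<le> ((vt + \<alpha> * L) / 2)\<^sup>2"
      using zero_le_power2[of "vt - \<alpha> * L"] by (simp add: power2_eq_square field_simps)
    also have "\<dots> \<le> 1\<^sup>2" using le2 vt \<alpha>0 L0 by (intro power_mono) auto
    finally have "vt * (\<alpha> * L) \<le> 1" by simp
    moreover have "vt * (\<alpha> * \<mu>) < vt * (\<alpha> * L)" using vt \<alpha>0 L by simp
    ultimately have "sqrt (vt * \<alpha> * \<mu>) < sqrt 1" by (intro real_sqrt_less_mono) (simp add: mult.assoc)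
    then have "vt * s < 1" using conv[OF \<alpha>0 vt] by simp
    moreover have "\<alpha> * \<psi> * \<mu> < 1"
    proof (cases "\<psi> = 0")
      case False
      then have "\<psi> * (\<alpha> * \<mu>) < \<psi> * (\<alpha> * L)" using \<psi>(1) \<alpha>0 L by simp
      with \<psi>(2) show ?thesis by (simp add: mult_ac)
    qed simp
    ultimately show ?thesis using \<alpha>0 vt st le2 by blast
  qed
  have "0 < \<alpha> \<and> 0 < vt \<and> vt * s < 1 \<and> \<alpha> * \<psi> * \<mu> < 1 \<and> \<alpha> * L * (1 - \<psi>) = 1 - vt \<and> vt + \<alpha> * L \<le> 2
     \<and> \<alpha> * L \<le> 3 * vt
     \<and> (1 - vt * s) * (vt + \<alpha> * L * (1 - \<psi>)\<^sup>2 - \<alpha> * \<mu> * \<psi>\<^sup>2) \<le> vt * (1 - \<alpha> * \<psi> * \<mu>)\<^sup>2"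
  proof (cases "(vt, \<psi>) \<in> S_c \<mu> L")
    case False
    with S have eq: "vt = 1" "\<psi> = 1" by (auto simp: S_zero_def)
    have \<alpha>0: "0 < \<alpha>" "\<alpha> * L \<le> 1"
      using \<alpha> L0 unfolding gmm_stepsize_def eq by (auto simp: S_zero_def field_simps)
    note r = reduce[unfolded eq, OF \<alpha>0(1)]
    have s: "0 < s" "\<alpha> * \<mu> = s\<^sup>2" using conv[unfolded eq, OF \<alpha>0(1)] by auto
    have "s < 1" using r \<alpha>0(2) by simp
    then have s2: "s\<^sup>2 \<le> s" using s(1) by (simp add: power2_eq_square)
    have "s\<^sup>2 \<le> 1" using s(1) \<open>s < 1\<close> by (simp add: power_le_one)
    then have "(1 - s) * (1 - s\<^sup>2) \<le> (1 - s\<^sup>2) * (1 - s\<^sup>2)"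
      using s2 by (intro mult_right_mono) auto
    with r \<alpha>0(2) show ?thesis unfolding eq by (simp add: s(2) power2_eq_square)
  next
    case True
    then have \<psi>1: "\<psi> \<noteq> 1" and one: "(vt, \<psi>) \<in> S_one \<mu> L"
      and pm: "(vt, \<psi>) \<in> S_minus (L / \<mu>) \<or> (vt, \<psi>) \<in> S_plus"
      by (auto simp: S_c_def S_one_def)
    have \<alpha>_eq: "\<alpha> = (1 - vt) / (L * (1 - \<psi>))"
      using \<alpha> True by (simp add: gmm_stepsize_def)
    then have st: "\<alpha> * L * (1 - \<psi>) = 1 - vt" using \<psi>1 L0 by simp
    have base: "0 < \<alpha> \<and> 0 < vt \<and> 0 \<le> \<psi> \<and> \<psi> * (\<alpha> * L) \<le> 1"
      using pm
    proof
      assume "(vt, \<psi>) \<in> S_plus"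
      then have p: "1 < \<psi>" "1 < vt" "vt \<le> 2 - 1 / \<psi>" by (auto simp: S_plus_def)
      have \<alpha>0: "0 < \<alpha>"
        unfolding \<alpha>_eq using p L0 by (intro divide_neg_neg mult_pos_neg) auto
      have "\<psi> * (\<alpha> * L) * (\<psi> - 1) = \<psi> * (vt - 1)" using st by algebra
      also have "\<dots> \<le> \<psi> - 1" using p by (simp add: field_simps)
      finally have "\<psi> * (\<alpha> * L) \<le> 1" using p(1) by (simp add: mult_le_cancel_right1)
      with \<alpha>0 p show ?thesis by auto
    next
      assume "(vt, \<psi>) \<in> S_minus (L / \<mu>)"
      then have p: "0 \<le> \<psi>" "\<psi> < 1" "vt < 1" "1 / (1 + L / \<mu> * (1 - \<psi>)) \<le> vt"
        and p2: "\<psi> \<noteq> 0 \<Longrightarrow> 2 - 1 / \<psi> \<le> vt"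
        by (auto simp: S_minus_def split: if_splits)
      have "0 < 1 / (1 + L / \<mu> * (1 - \<psi>))" using p \<mu> L0 by (simp add: add_pos_nonneg)
      then have vt: "0 < vt" using p(4) by linarith
      have \<alpha>0: "0 < \<alpha>" using p L0 by (simp add: \<alpha>_eq)
      have "\<psi> * (\<alpha> * L) * (1 - \<psi>) = \<psi> * (1 - vt)" using st by algebra
      also have "\<dots> \<le> 1 - \<psi>" using p p2 by (cases "\<psi> = 0") (auto simp: field_simps)
      finally have "\<psi> * (\<alpha> * L) \<le> 1" using p(2) by (simp add: mult_le_cancel_right1)
      with \<alpha>0 vt p show ?thesis by auto
    qed
    then have \<alpha>0: "0 < \<alpha>" and vt: "0 < vt" and \<psi>: "0 \<le> \<psi>" "\<psi> * (\<alpha> * L) \<le> 1" by auto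
    note c = conv[OF \<alpha>0 vt]
    have ineq: "(1 - vt * s) * (vt + \<alpha> * L * (1 - \<psi>)\<^sup>2 - \<alpha> * \<mu> * \<psi>\<^sup>2) \<le> vt * (1 - \<alpha> * \<psi> * \<mu>)\<^sup>2"
    proof -
      have a: "(1 - vt) * vt / (L / \<mu> * (1 - \<psi>)) = vt * \<alpha> * \<mu>"
        "(1 - vt) * \<psi> / (L / \<mu> * (1 - \<psi>)) = \<alpha> * \<psi> * \<mu>"
        "(1 - vt) * (\<mu> * \<psi>\<^sup>2 - L * (1 - \<psi>)\<^sup>2) / (L * (1 - \<psi>) * vt)
          = \<alpha> * (\<mu> * \<psi>\<^sup>2 - L * (1 - \<psi>)\<^sup>2) / vt"
        using \<psi>1 L0 \<mu> by (simp_all add: \<alpha>_eq)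
      have "(1 - vt * s) * (1 - \<alpha> * (\<mu> * \<psi>\<^sup>2 - L * (1 - \<psi>)\<^sup>2) / vt) \<le> (1 - \<alpha> * \<psi> * \<mu>)\<^sup>2"
        using one c unfolding S_one_def by (simp only: a mem_Collect_eq prod.case)
      then have "vt * ((1 - vt * s) * (1 - \<alpha> * (\<mu> * \<psi>\<^sup>2 - L * (1 - \<psi>)\<^sup>2) / vt)) \<le> vt * (1 - \<alpha> * \<psi> * \<mu>)\<^sup>2"
        using vt by (intro mult_left_mono) auto
      also have "vt * ((1 - vt * s) * (1 - \<alpha> * (\<mu> * \<psi>\<^sup>2 - L * (1 - \<psi>)\<^sup>2) / vt))
          = (1 - vt * s) * (vt + \<alpha> * L * (1 - \<psi>)\<^sup>2 - \<alpha> * \<mu> * \<psi>\<^sup>2)"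
        using vt by (simp add: field_simps)
      finally show ?thesis .
    qed
    have "\<alpha> * L \<le> 3 * vt"
      using pm
    proof
      assume "(vt, \<psi>) \<in> S_plus"
      then have p: "1 < \<psi>" "1 < vt" by (auto simp: S_plus_def)
      have "1 * (\<alpha> * L) \<le> \<psi> * (\<alpha> * L)" using p \<alpha>0 L0 by (intro mult_right_mono) auto
      with \<psi>(2) p(2) show ?thesis by linarith
    next
      assume "(vt, \<psi>) \<in> S_minus (L / \<mu>)"
      then have p: "\<psi> < 1" "1 / (1 + L / \<mu> * (1 - \<psi>)) \<le> vt"
        by (auto simp: S_minus_def split: if_splits)
      define \<epsilon> where "\<epsilon> = 1 - \<psi>"
      define h where "h = 1 / vt"
      define q where "q = \<alpha> * L * h"
      have \<epsilon>: "0 < \<epsilon>" "\<epsilon> \<le> 1" using p \<psi> by (auto simp: \<epsilon>_def)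
      have h: "vt = 1 / h" "0 < h" using vt by (auto simp: h_def)
      have \<alpha>L: "\<alpha> * L = q / h" using h by (simp add: q_def)
      have hq: "h = 1 + \<epsilon> * q"
        using st vt by (simp add: \<epsilon>_def[symmetric] q_def h_def field_simps)
      have s1: "s \<le> 1"
      proof -
        have "1 \<le> vt * (1 + L / \<mu> * \<epsilon>)"
          using p(2) \<epsilon> \<mu> L0 by (simp add: \<epsilon>_def[symmetric] field_simps add_pos_pos)
        then have "\<mu> * (1 - vt) \<le> L * (\<epsilon> * vt)" using \<mu> by (simp add: field_simps)
        moreover have "\<mu> * (1 - vt) = L * (\<epsilon> * (\<alpha> * \<mu>))"
          using st by (simp add: \<epsilon>_def[symmetric] mult_ac flip: st)
        ultimately have "\<epsilon> * (\<alpha> * \<mu>) \<le> \<epsilon> * vt" using L0 by simp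
        then have "\<alpha> * \<mu> / vt \<le> 1" using \<epsilon>(1) vt by simp
        then show ?thesis by (simp add: s_def)
      qed
      show ?thesis
      proof (rule ccontr)
        assume "\<not> \<alpha> * L \<le> 3 * vt"
        then have q: "3 < q" using h by (simp add: \<alpha>L) (simp add: h field_simps)
        have "(1 - \<epsilon>) * q \<le> h" using \<psi>(2) h by (simp add: \<alpha>L \<epsilon>_def)
        then have hq2: "q + 1 \<le> 2 * h" using hq by (simp add: algebra_simps)
        have "(h - s\<^sup>2 * (1 - \<epsilon>))\<^sup>2 < h * (h - s) * (1 + \<epsilon> * (h - 1) - s\<^sup>2 * (1 - \<epsilon>)\<^sup>2)"
        proof (rule S_one_violated_beyond_ratio)
          have "h - 1 = \<epsilon> * q" using hq by simp
          also have "\<dots> \<le> \<epsilon> * (2 * h - 1)" using \<epsilon> hq2 by (intro mult_left_mono) auto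
          finally show "h - 1 \<le> \<epsilon> * (2 * h - 1)" .
        qed (use hq2 q \<epsilon> c s1 in auto)
        moreover have "h ^ 3 * ((1 - vt * s) * (vt + \<alpha> * L * (1 - \<psi>)\<^sup>2 - \<alpha> * \<mu> * \<psi>\<^sup>2))
            = h * (h - s) * (1 + \<epsilon> * (h - 1) - s\<^sup>2 * (1 - \<epsilon>)\<^sup>2)"
        proof -
          have "\<psi> = 1 - \<epsilon>" "\<alpha> * \<mu> = 1 / h * s\<^sup>2" "\<epsilon> * (h - 1) = q * \<epsilon>\<^sup>2"
            using c h hq by (simp_all add: \<epsilon>_def power2_eq_square)
          then show ?thesis
            using h(2) unfolding h(1) \<alpha>L by (simp only:) (simp add: field_simps power3_eq_cube)
        qed
        moreover have "h ^ 3 * (vt * (1 - \<alpha> * \<psi> * \<mu>)\<^sup>2) = (h - s\<^sup>2 * (1 - \<epsilon>))\<^sup>2"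
        proof -
          have "\<alpha> * \<psi> * \<mu> = \<alpha> * \<mu> * (1 - \<epsilon>)" by (simp add: \<epsilon>_def)
          also have "\<dots> = 1 / h * s\<^sup>2 * (1 - \<epsilon>)" using c h by simp
          finally have "\<alpha> * \<psi> * \<mu> = 1 / h * s\<^sup>2 * (1 - \<epsilon>)" .
          then show ?thesis
            using h(2) unfolding h(1) by (simp only:) (simp add: field_simps power3_eq_cube power2_eq_square)
        qed
        moreover have "h ^ 3 * ((1 - vt * s) * (vt + \<alpha> * L * (1 - \<psi>)\<^sup>2 - \<alpha> * \<mu> * \<psi>\<^sup>2))
            \<le> h ^ 3 * (vt * (1 - \<alpha> * \<psi> * \<mu>)\<^sup>2)"
          using ineq h(2) by (intro mult_left_mono) auto
        ultimately show False by linarith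
      qed
    qed
    with reduce[OF \<alpha>0 vt \<psi> st] ineq show ?thesis by blast
  qed
  then show "0 < \<alpha>" "0 < vt" "0 < s" "\<alpha> * \<mu> = vt * s\<^sup>2" "sqrt (vt * \<alpha> * \<mu>) = vt * s" "vt * s < 1"
    "\<alpha> * \<psi> * \<mu> < 1" "\<alpha> * L * (1 - \<psi>) = 1 - vt" "vt + \<alpha> * L \<le> 2" "\<alpha> * L \<le> 3 * vt"
    "(1 - vt * s) * (vt + \<alpha> * L * (1 - \<psi>)\<^sup>2 - \<alpha> * \<mu> * \<psi>\<^sup>2) \<le> vt * (1 - \<alpha> * \<psi> * \<mu>)\<^sup>2"
    using conv by auto
qed


text \<open>Put \<open>c = 4 \<theta> \<alpha>\<^sup>2 v / D\<close>. Then \<open>rho_bar_sq\<close> is the larger root of \<open>X\<^sup>2 = (1 - r + c) X + c\<close>. It is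
  below \<open>1\<close> if and only if \<open>2 c < r\<close>, which is the condition \<open>\<theta> < theta_max\<close>. The rate \<open>2 (1 - r) / D\<close> of
  the energy lies below that root because it satisfies the equation with \<open>\<le>\<close>: as
  \<open>\<alpha> L \<le> 3 \<vartheta>\<close>, the summand \<open>\<vartheta> (1 - r) / (2 \<alpha>)\<close> of \<open>v\<close> makes \<open>c\<close> large enough for this.\<close>

lemma risk_parameter_rate:
  fixes \<mu> L vt \<alpha> v \<theta> r :: real
  assumes pos: "0 < \<mu>" "0 < L" "0 < vt" "0 < \<alpha>" and r: "r = sqrt (vt * \<alpha> * \<mu>)" "r < 1"
    and \<alpha>L: "\<alpha> * L \<le> 3 * vt" and v: "vt / (2 * \<alpha>) * (1 - r) \<le> v"
    and \<theta>: "0 < \<theta>" "\<theta> < theta_max \<mu> L vt \<alpha> v"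
  defines "D \<equiv> 2 - \<theta> * \<alpha> * (vt + \<alpha> * L)"
  shows "0 < D" "2 * (1 - r) / D < 1" "2 * (1 - r) / D \<le> rho_bar_sq \<mu> L vt \<alpha> v \<theta>"
    "rho_bar_sq \<mu> L vt \<alpha> v \<theta> < 1"
proof -
  \<comment> \<open>These are the square roots that occur in \<open>theta_max\<close>.\<close>
  define m where "m = sqrt (vt * \<mu>)"
  define a where "a = sqrt \<alpha>"
  have m: "0 < m" "0 < a" "a * a = \<alpha>" "r = m * a"
    using pos by (auto simp: m_def a_def r(1) real_sqrt_mult mult_ac)
  have r0: "0 < r" using m by simp
  have v0: "0 \<le> v" using v pos r(2) by (intro order_trans[OF _ v]) simp
  have sL: "0 < vt + \<alpha> * L" using pos by (simp add: add_pos_pos)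
  have den: "0 < \<alpha> * (8 * v * a + m * (vt + \<alpha> * L))"
    using pos m v0 sL by (intro mult_pos_pos add_nonneg_pos) auto
  have "\<theta> * (\<alpha> * (8 * v * a + m * (vt + \<alpha> * L))) < 2 * m"
    using \<theta>(2) den unfolding theta_max_def m_def[symmetric] a_def[symmetric]
    by (simp add: pos_less_divide_eq)
  then have "\<theta> * (\<alpha> * (8 * v * a + m * (vt + \<alpha> * L))) * a < 2 * m * a"
    using m(2) by simp
  then have main: "8 * \<theta> * \<alpha>\<^sup>2 * v + r * (\<theta> * \<alpha> * (vt + \<alpha> * L)) < 2 * r"
    by (simp add: m(4) m(3)[symmetric] algebra_simps power2_eq_square)
  have av: "4 * vt * (1 - r) \<le> 8 * \<alpha> * v"
    using mult_left_mono[OF v, of "8 * \<alpha>"] pos by simp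
  have "\<theta> * \<alpha> * (vt + \<alpha> * L) < 2 * r"
  proof -
    have "(1 - r) * (vt + \<alpha> * L) \<le> (1 - r) * (4 * vt)"
      using \<alpha>L r(2) by (intro mult_left_mono) auto
    also have "\<dots> \<le> 8 * \<alpha> * v" using av by (simp add: mult_ac)
    finally have "\<theta> * \<alpha> * ((1 - r) * (vt + \<alpha> * L)) \<le> \<theta> * \<alpha> * (8 * \<alpha> * v)"
      using pos \<theta>(1) by (intro mult_left_mono) auto
    with main show ?thesis by (simp add: algebra_simps power2_eq_square)
  qed
  then have Dr: "2 * (1 - r) < D" by (simp add: D_def)
  moreover have "0 < 2 * (1 - r)" using r(2) by simp
  ultimately show D: "0 < D" by (rule less_trans[rotated])
  show \<rho>1: "2 * (1 - r) / D < 1" using Dr D by simp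
  define c where "c = 4 * \<theta> * \<alpha>\<^sup>2 * v / D"
  define p where "p = 1 - r + c"
  define \<rho> where "\<rho> = 2 * (1 - r) / D"
  have c0: "0 \<le> c" using v0 \<theta>(1) D by (simp add: c_def)
  have rho: "rho_bar_sq \<mu> L vt \<alpha> v \<theta> = (p + sqrt (p\<^sup>2 + 4 * c)) / 2"
    unfolding rho_bar_sq_def Let_def r(1)[symmetric] D_def[symmetric] p_def c_def
    by (simp add: field_simps)
  have "2 * c < r"
  proof -
    have "8 * \<theta> * \<alpha>\<^sup>2 * v < r * D" using main by (simp add: D_def algebra_simps)
    then show ?thesis using D by (simp add: c_def pos_divide_less_eq)
  qed
  then have pc: "p + c < 1" by (simp add: p_def)
  have "sqrt (p\<^sup>2 + 4 * c) < sqrt ((2 - p)\<^sup>2)"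
    using pc by (intro real_sqrt_less_mono) (simp add: power2_eq_square algebra_simps)
  also have "\<dots> = 2 - p" using pc c0 by simp
  finally show "rho_bar_sq \<mu> L vt \<alpha> v \<theta> < 1" unfolding rho by simp
  have "\<rho> * (\<rho> - (1 - r)) \<le> c * (1 + \<rho>)"
  proof -
    have \<rho>0: "0 \<le> \<rho>" "\<rho> < 1" using \<rho>1 D r(2) by (auto simp: \<rho>_def)
    have "\<rho> * (vt + \<alpha> * L) \<le> \<rho> * (4 * vt)" using \<alpha>L \<rho>0 by (intro mult_left_mono) auto
    also have "\<dots> = 4 * vt * \<rho>" by simp
    also have "\<dots> \<le> 2 * vt * (1 + \<rho>)" using \<rho>0 pos by (simp add: algebra_simps)
    finally have "(1 - r) * (\<rho> * (vt + \<alpha> * L)) \<le> (1 - r) * (2 * vt * (1 + \<rho>))"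
      using r(2) by (intro mult_left_mono) auto
    also have "\<dots> = 4 * vt * (1 - r) / 2 * (1 + \<rho>)" by simp
    also have "\<dots> \<le> 8 * \<alpha> * v / 2 * (1 + \<rho>)"
      using av \<rho>0 by (intro mult_right_mono divide_right_mono) auto
    finally have "\<theta> * \<alpha> / D * ((1 - r) * (\<rho> * (vt + \<alpha> * L))) \<le> \<theta> * \<alpha> / D * (8 * \<alpha> * v / 2 * (1 + \<rho>))"
      using pos D \<theta>(1) by (intro mult_left_mono) auto
    moreover have "\<theta> * \<alpha> / D * (8 * \<alpha> * v / 2 * (1 + \<rho>)) = c * (1 + \<rho>)"
      by (simp add: c_def power2_eq_square)
    moreover have "\<rho> - (1 - r) = (1 - r) * (\<theta> * \<alpha> * (vt + \<alpha> * L)) / D"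
    proof -
      have "\<rho> - (1 - r) = (1 - r) * (2 - D) / D" using D by (simp add: \<rho>_def field_simps)
      then show ?thesis by (simp add: D_def)
    qed
    ultimately show ?thesis by (simp add: mult_ac)
  qed
  then have "(2 * \<rho> - p)\<^sup>2 \<le> p\<^sup>2 + 4 * c"
    by (simp add: p_def power2_eq_square algebra_simps)
  then have "2 * \<rho> - p \<le> sqrt (p\<^sup>2 + 4 * c)" by (rule real_le_rsqrt)
  then show "2 * (1 - r) / D \<le> rho_bar_sq \<mu> L vt \<alpha> v \<theta>"
    unfolding rho \<rho>_def[symmetric] by simp
qed

section \<open>Lyapunov function and entropic risk\<close>

lemma lyap_P_eq:
  fixes x x' xs :: "real ^ 'n"
  assumes "0 < \<alpha>" "0 < vt" "0 < s" and s: "\<alpha> * \<mu> = vt * s\<^sup>2"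
  shows "lyap f xs (lyap_P \<mu> vt \<alpha>) x x'
    = vt / (2 * \<alpha>) * (norm ((x - x') + s *\<^sub>R (x' - xs)))\<^sup>2 + (f x - f xs)"
proof -
  define p where "p = sqrt (vt / (2 * \<alpha>))"
  define q where "q = - p + sqrt (\<mu> / 2)"
  define a b where "a = x - xs" and "b = x' - xs"
  have split: "(\<Sum>i\<in>UNIV. g i) = (\<Sum>l\<in>UNIV. g (1, l) + g (2, l))" for g :: "2 \<times> 'n \<Rightarrow> real"
  proof -
    have "(\<Sum>i\<in>UNIV. g i) = (\<Sum>k\<in>UNIV. \<Sum>l\<in>UNIV. g (k, l))"
      by (simp add: sum.cartesian_product)
    then show ?thesis by (simp add: sum_2 sum.distrib)
  qed
  have st: "stack x x' - stack xs xs = stack a b"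
    by (simp add: vec_eq_iff stack_def a_def b_def)
  have P: "lyap_P \<mu> vt \<alpha> $ i $ j = (if fst i = 1 then p else q) * (if fst j = 1 then p else q)
      * (if snd i = snd j then 1 else 0)" for i j :: "2 \<times> 'n"
  proof -
    have "lyap_p \<mu> vt \<alpha> $ k = (if k = 1 then p else q)" for k
      using exhaust_2[of k] by (auto simp: lyap_p_def p_def q_def)
    then show ?thesis by (simp add: lyap_P_def kronecker_def outer_def mat_def)
  qed
  have "stack a b \<bullet> (lyap_P \<mu> vt \<alpha> *v stack a b) = (norm (p *\<^sub>R a + q *\<^sub>R b))\<^sup>2"
    unfolding power2_norm_eq_inner inner_vec_def matrix_vector_mult_def P split
    by (simp add: stack_def if_distrib[of "\<lambda>u. _ * u"] if_distrib[of "\<lambda>u. u * _"]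
        sum.distrib algebra_simps cong: if_cong)
  also have "p *\<^sub>R a + q *\<^sub>R b = p *\<^sub>R ((x - x') + s *\<^sub>R (x' - xs))"
  proof -
    have "\<mu> / 2 = (p * s)\<^sup>2"
      using assms by (simp add: p_def power_mult_distrib field_simps)
    then have "sqrt (\<mu> / 2) = p * s" using assms by (simp add: p_def)
    then show ?thesis by (simp add: q_def a_def b_def algebra_simps)
  qed
  also have "(norm (p *\<^sub>R ((x - x') + s *\<^sub>R (x' - xs))))\<^sup>2
      = vt / (2 * \<alpha>) * (norm ((x - x') + s *\<^sub>R (x' - xs)))\<^sup>2"
    using assms by (simp add: p_def power_mult_distrib)
  finally show ?thesis by (simp add: lyap_def st)
qed

text \<open>As \<open>X\<close> is nonnegative its exponential moment is at least \<open>1\<close>, so the logarithm is that of a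
  positive real number and is monotone.\<close>

lemma entropic_risk_le:
  assumes M: "prob_space M" and \<sigma>: "0 < \<sigma>" and \<theta>: "0 < \<theta>"
    and X: "\<And>\<omega>. 0 \<le> X \<omega>"
    and E: "(\<integral>\<^sup>+ \<omega>. ennreal (exp (\<theta> / (2 * \<sigma>\<^sup>2) * X \<omega>)) \<partial>M) \<le> ennreal (exp (\<theta> / (2 * \<sigma>\<^sup>2) * R))"
  shows "\<bar>entropic_risk M \<sigma> \<theta> X\<bar> \<noteq> \<infinity> \<and> entropic_risk M \<sigma> \<theta> X \<le> ereal R"
proof -
  interpret prob_space M by (rule M)
  define I where "I = (\<integral>\<^sup>+ \<omega>. ennreal (exp (\<theta> / (2 * \<sigma>\<^sup>2) * X \<omega>)) \<partial>M)"
  have "(\<integral>\<^sup>+ \<omega>. 1 \<partial>M) \<le> I"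
    unfolding I_def
  proof (rule nn_integral_mono)
    fix \<omega>
    have "ennreal 1 \<le> ennreal (exp (\<theta> / (2 * \<sigma>\<^sup>2) * X \<omega>))"
      using X[of \<omega>] \<theta> by (intro ennreal_leI) simp
    then show "1 \<le> ennreal (exp (\<theta> / (2 * \<sigma>\<^sup>2) * X \<omega>))" by simp
  qed
  then have I1: "1 \<le> I" by (simp add: emeasure_space_1)
  have I2: "I \<le> ennreal (exp (\<theta> / (2 * \<sigma>\<^sup>2) * R))" using E by (simp add: I_def)
  then have fin: "I \<noteq> \<infinity>" using le_less_trans[OF _ ennreal_less_top] by (auto simp: less_top)
  have "1 \<le> enn2real I" using I1 fin
    by (metis enn2real_1 enn2real_mono infinity_ennreal_def less_top)
  moreover have "enn2real I \<le> exp (\<theta> / (2 * \<sigma>\<^sup>2) * R)"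
    using I2 by (intro enn2real_leI) auto
  ultimately have "ln (enn2real I) \<le> \<theta> / (2 * \<sigma>\<^sup>2) * R"
    by (metis exp_gt_zero ln_exp ln_mono order_less_le_trans zero_less_one)
  then have "2 * \<sigma>\<^sup>2 / \<theta> * ln (enn2real I) \<le> 2 * \<sigma>\<^sup>2 / \<theta> * (\<theta> / (2 * \<sigma>\<^sup>2) * R)"
    using \<theta> by (intro mult_left_mono) auto
  also have "\<dots> = R" using \<theta> \<sigma> by simp
  finally show ?thesis
    using fin unfolding entropic_risk_def Let_def I_def[symmetric] by simp
qed

theorem proposition3:
  fixes f :: "real ^ 'd \<Rightarrow> real"
    and M :: "'w measure"
    and w :: "nat \<Rightarrow> 'w \<Rightarrow> real ^ 'd"
    and x0 xm1 xs :: "real ^ 'd"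
    and \<mu> L \<sigma> vt \<psi> \<alpha> \<beta> \<gamma> v \<theta> :: real
  assumes "prob_space M"
    and "0 < \<mu>" and "\<mu> < L" and "0 < \<sigma>"
    and "strongly_convex \<mu> f" and "L_smooth L f"
    and "is_arg_min f (\<lambda>_. True) xs"
    and "(vt, \<psi>) \<in> S_zero \<union> S_c \<mu> L"
    and "gmm_stepsize \<mu> L vt \<psi> \<alpha>"
    and "\<beta> = gmm_beta \<mu> vt \<psi> \<alpha>" and "\<gamma> = \<psi> * \<beta>"
    and "gaussian_gradient_noise M \<sigma> w (gmm f \<alpha> \<beta> \<gamma> x0 xm1 w)"
    and "v = v_const \<mu> L vt \<alpha> \<beta> \<gamma>"
    and "0 < \<theta>" and "\<theta> < theta_max \<mu> L vt \<alpha> v"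
  shows "rho_bar_sq \<mu> L vt \<alpha> v \<theta> < 1
    \<and> (\<forall>k. \<bar>entropic_risk M \<sigma> \<theta> (\<lambda>\<omega>. f (gmm f \<alpha> \<beta> \<gamma> x0 xm1 w k \<omega>) - f xs)\<bar> \<noteq> \<infinity>
         \<and> entropic_risk M \<sigma> \<theta> (\<lambda>\<omega>. f (gmm f \<alpha> \<beta> \<gamma> x0 xm1 w k \<omega>) - f xs)
           < ereal (\<sigma>\<^sup>2 * real CARD('d) * \<alpha> * (vt + \<alpha> * L)
                      / ((1 - rho_bar_sq \<mu> L vt \<alpha> v \<theta>) * (2 - \<theta> * \<alpha> * (vt + \<alpha> * L)))
                    + rho_bar_sq \<mu> L vt \<alpha> v \<theta> ^ k * 2 * lyap f xs (lyap_P \<mu> vt \<alpha>) x0 xm1))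
    \<and> limsup (\<lambda>k. entropic_risk M \<sigma> \<theta> (\<lambda>\<omega>. f (gmm f \<alpha> \<beta> \<gamma> x0 xm1 w k \<omega>) - f xs))
        \<le> ereal (\<sigma>\<^sup>2 * real CARD('d) * \<alpha> * (vt + \<alpha> * L)
                      / ((1 - rho_bar_sq \<mu> L vt \<alpha> v \<theta>) * (2 - \<theta> * \<alpha> * (vt + \<alpha> * L))))"
proof -
  note M = assms(1) and \<mu> = assms(2) and \<sigma> = assms(4) and \<theta> = assms(14) and noise = assms(12)
  have L: "0 < L" using assms by simp
  have min: "f xs \<le> f z" for z using assms(7) by (simp add: is_arg_min_linorder)
  define s where "s = sqrt (\<alpha> * \<mu> / vt)"
  define r where "r = vt * s"
  note par = admissible_parameters[OF assms(2,3,8,9), folded s_def]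
  have r: "r = sqrt (vt * \<alpha> * \<mu>)" "r < 1" using par(5,6) by (simp_all add: r_def)
  have mom: "\<beta> * (1 - \<alpha> * \<psi> * \<mu>) = (1 - vt * s) * (1 - s)"
    unfolding assms(10) gmm_beta_def par(5) s_def[symmetric] using par(7) by simp
  interpret tuned_gmm f xs \<mu> L \<alpha> \<beta> \<gamma> \<psi> vt s
  proof
    let ?c = "1 - \<alpha> * \<psi> * \<mu>"
    let ?Q = "vt + \<alpha> * L * (1 - \<psi>)\<^sup>2 - \<alpha> * \<mu> * \<psi>\<^sup>2"
    have c: "0 < ?c" using par(7) by simp
    \<comment> \<open>Substituting the definition of \<open>\<beta>\<close> turns this into the last estimate of \<open>admissible_parameters\<close>.\<close>
    have "?c\<^sup>2 * (\<beta>\<^sup>2 * ?Q) = (\<beta> * ?c)\<^sup>2 * ?Q" by (simp add: power_mult_distrib)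
    also have "\<dots> = (1 - vt * s) * (1 - s)\<^sup>2 * ((1 - vt * s) * ?Q)"
      unfolding mom by (simp add: power_mult_distrib power2_eq_square)
    also have "\<dots> \<le> (1 - vt * s) * (1 - s)\<^sup>2 * (vt * ?c\<^sup>2)"
      using par(6,11) by (intro mult_left_mono) auto
    also have "\<dots> = ?c\<^sup>2 * (vt * ((1 - vt * s) * (1 - s)\<^sup>2))" by (simp add: mult_ac)
    finally show "\<beta>\<^sup>2 * ?Q \<le> vt * ((1 - vt * s) * (1 - s)\<^sup>2)"
      using c by (simp add: mult_le_cancel_left_pos)
  qed (use assms L min par mom in auto)
  define D where "D = 2 - \<theta> * \<alpha> * (vt + \<alpha> * L)"
  define \<rho> where "\<rho> = 2 * (1 - r) / D"
  define \<rho>' where "\<rho>' = rho_bar_sq \<mu> L vt \<alpha> v \<theta>"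
  define b where "b = \<sigma>\<^sup>2 * real CARD('d) * \<alpha> * (vt + \<alpha> * L) / D"
  have "vt / (2 * \<alpha>) * (1 - r) \<le> v"
  proof -
    have "1 + 2 * \<gamma> + 2 * \<gamma>\<^sup>2 = (1 + \<gamma>)\<^sup>2 + \<gamma>\<^sup>2" by (simp add: power2_eq_square algebra_simps)
    then have "0 \<le> 1 + 2 * \<gamma> + 2 * \<gamma>\<^sup>2" by (simp only: sum_power2_ge_zero)
    then have "0 \<le> (1 - \<alpha> * L)\<^sup>2 * (1 + 2 * \<gamma> + 2 * \<gamma>\<^sup>2)"
      by (rule mult_nonneg_nonneg[OF zero_le_power2])
    then have "0 \<le> 2 * (\<beta> - \<gamma>)\<^sup>2 + (1 - \<alpha> * L)\<^sup>2 * (1 + 2 * \<gamma> + 2 * \<gamma>\<^sup>2)"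
      by (rule add_nonneg_nonneg[rotated]) simp
    then have "0 \<le> 2 * L\<^sup>2 / \<mu> * (2 * (\<beta> - \<gamma>)\<^sup>2 + (1 - \<alpha> * L)\<^sup>2 * (1 + 2 * \<gamma> + 2 * \<gamma>\<^sup>2))"
      by (rule mult_nonneg_nonneg[rotated]) (use \<mu> in simp)
    then show ?thesis unfolding assms(13) v_const_def r(1) by linarith
  qed
  note rate = risk_parameter_rate[OF \<mu> L par(2,1) r par(10) this assms(14,15), folded D_def, folded \<rho>_def \<rho>'_def]
  have \<rho>0: "0 < \<rho>" using r(2) rate(1) by (simp add: \<rho>_def)
  have b0: "0 < b" using \<sigma> par(1,2) L rate(1) by (simp add: b_def add_pos_pos)
  define V0 where "V0 = energy x0 xm1"
  have V0: "0 \<le> V0" "lyap f xs (lyap_P \<mu> vt \<alpha>) x0 xm1 = V0"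
    using energy_nonneg lyap_P_eq[OF par(1-4), of f xs x0 xm1] by (simp_all add: V0_def energy_def)
  define bound where "bound k = \<rho> ^ k * V0 + (1 - \<rho> ^ k) / (1 - \<rho>) * b" for k
  define X where "X k \<omega> = f (gmm f \<alpha> \<beta> \<gamma> x0 xm1 w k \<omega>) - f xs" for k \<omega>
  have risk: "\<bar>entropic_risk M \<sigma> \<theta> (X k)\<bar> \<noteq> \<infinity> \<and> entropic_risk M \<sigma> \<theta> (X k) \<le> ereal (bound k)" for k
  proof (rule entropic_risk_le[OF M \<sigma> \<theta>])
    show "0 \<le> X k \<omega>" for \<omega> using min by (simp add: X_def)
    have "(\<integral>\<^sup>+ \<omega>. ennreal (exp (\<theta> / (2 * \<sigma>\<^sup>2) * X k \<omega>)) \<partial>M)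
      \<le> (\<integral>\<^sup>+ \<omega>. ennreal (exp (\<theta> / (2 * \<sigma>\<^sup>2) * energy (gmm f \<alpha> \<beta> \<gamma> x0 xm1 w k \<omega>)
            (case k of 0 \<Rightarrow> xm1 | Suc j \<Rightarrow> gmm f \<alpha> \<beta> \<gamma> x0 xm1 w j \<omega>))) \<partial>M)"
      using \<theta> gap_le_energy unfolding X_def
      by (intro nn_integral_mono ennreal_leI) (auto intro!: mult_left_mono divide_right_mono)
    also have "\<dots> \<le> ennreal (exp (\<theta> / (2 * \<sigma>\<^sup>2) * bound k))"
      unfolding bound_def V0_def
      by (rule exp_moment_energy_le[OF M noise \<sigma> \<theta> D_def rate(1) refl _ rate(2) b_def])
         (simp add: \<rho>_def r_def)
    finally show "(\<integral>\<^sup>+ \<omega>. ennreal (exp (\<theta> / (2 * \<sigma>\<^sup>2) * X k \<omega>)) \<partial>M)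
      \<le> ennreal (exp (\<theta> / (2 * \<sigma>\<^sup>2) * bound k))" .
  qed
  have steady: "b / (1 - \<rho>) \<le> b / (1 - \<rho>')"
    using b0 rate by (intro divide_left_mono) auto
  have strict: "bound k < b / (1 - \<rho>') + \<rho>' ^ k * 2 * V0" for k
  proof -
    have "(1 - \<rho> ^ k) / (1 - \<rho>) * b = b / (1 - \<rho>) - \<rho> ^ k * b / (1 - \<rho>)"
      by (simp add: diff_divide_distrib left_diff_distrib)
    moreover have "0 < \<rho> ^ k * b / (1 - \<rho>)" using \<rho>0 b0 rate(2) by simp
    moreover have "\<rho> ^ k * V0 \<le> \<rho>' ^ k * V0"
      using \<rho>0 rate(3) V0(1) by (intro mult_right_mono power_mono) auto
    moreover have "0 \<le> \<rho>' ^ k * V0" using \<rho>0 rate(3) V0(1) by simp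
    ultimately show ?thesis using steady unfolding bound_def by linarith
  qed
  have b_eq: "\<sigma>\<^sup>2 * real CARD('d) * \<alpha> * (vt + \<alpha> * L) / ((1 - \<rho>') * D) = b / (1 - \<rho>')"
    by (simp add: b_def mult.commute)
  have "bound \<longlonglongrightarrow> 0 * V0 + (1 - 0) / (1 - \<rho>) * b"
    unfolding bound_def using \<rho>0 rate(2) by (intro tendsto_intros LIMSEQ_realpow_zero) auto
  then have "(\<lambda>k. ereal (bound k)) \<longlonglongrightarrow> ereal (b / (1 - \<rho>))" by simp
  then have "limsup (\<lambda>k. ereal (bound k)) = ereal (b / (1 - \<rho>))"
    by (rule lim_imp_Limsup[OF sequentially_bot])
  moreover have "limsup (\<lambda>k. entropic_risk M \<sigma> \<theta> (X k)) \<le> limsup (\<lambda>k. ereal (bound k))"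
    using risk by (intro Limsup_mono) auto
  ultimately have lim: "limsup (\<lambda>k. entropic_risk M \<sigma> \<theta> (X k)) \<le> ereal (b / (1 - \<rho>'))"
    using steady by (auto intro: order_trans)
  have strict_risk: "entropic_risk M \<sigma> \<theta> (X k) < ereal (b / (1 - \<rho>') + \<rho>' ^ k * 2 * V0)" for k
    using risk[of k] strict[of k] by (auto intro: le_less_trans)
  show ?thesis
    unfolding D_def[symmetric] \<rho>'_def[symmetric] V0(2) b_eq
    by (intro conjI allI rate(4) lim[unfolded X_def[abs_def]] conjunct1[OF risk[unfolded X_def[abs_def]]]
        strict_risk[unfolded X_def[abs_def]])
qed

end
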